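(* (First Recurrence Theorem for $\leq_1$) Let $\rho$ be an additively indecomposable ordinal. If $\alpha,\beta$ are ordinals with $\alpha+1<\theta_1$ and $0<\beta<\theta_1$, then $I_{\alpha+\beta}\cong I_\beta$.
   Context: $ORD$ is the class of ordinals with its usual order and arithmetic; intervals are intervals of ordinals. $\rho$ is a fixed additively indecomposable ordinal (nonzero and closed under addition; $\rho=1$ is allowed). An ordinal $\beta$ is divisible by (a multiple of) $\alpha$ if $\beta=\alpha\cdot\delta$ for some $\delta$. For $\xi<\rho$ define $f_\xi:ORD\to ORD$ by $f_\xi(\rho\cdot\zeta)=\rho\cdot\zeta+\xi$ and $f_\xi(\rho\cdot\zeta+\epsilon)=\rho\cdot\zeta$ if $0<\epsilon<\rho$. A set $X$ of ordinals is closed if $\sigma\in X$ whenever $\sigma$ is divisible by $\rho$ and $\sigma+\xi\in X$ for some $\xi<\rho$. For sets of ordinals, $X<Y$ means $x<y$ for all $x\in X$, $y\in Y$. Binary relations $\leq_1,\leq_2$ on $ORD$ are defined by recursion on the larger argument $\beta$ as below. A covering of a closed set $X$ is a strictly increasing $h:X\to ORD$ such that for all $x,y\in X$: $f_\xi(x)=y$ iff $f_\xi(h(x))=h(y)$ for every $\xi<\rho$; and $x\leq_k y$ implies $h(x)\leq_k h(y)$ for $k=1,2$. A set $Z$ is a covering of $X$ if it is the range of a covering of $X$. "Cofinally many $\tilde Y$ below $\alpha$" with a property means: for every $\gamma<\alpha$ there is such a finite $\tilde Y\subseteq(\gamma,\alpha)$. (i) $\alpha\leq_1\beta$ iff $\alpha\leq\beta$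 and for all finite $X\subseteq\alpha$ and finite $Y\subseteq[\alpha,\beta)$ with $X\cup Y$ closed there is a finite $\tilde Y\subseteq\alpha$ with $X<\tilde Y$ such that $X\cup\tilde Y$ is a covering of $X\cup Y$. (ii) $\alpha\leq_2\beta$ iff $\alpha\leq\beta$ and both of the following hold. (Up, written $\alpha\leq_2\uparrow\beta$) For all finite $X,Y\subseteq\alpha$ with $X\cup Y$ closed and $X<Y$: if there are cofinally many $\tilde Y$ below $\alpha$ such that $X\cup\tilde Y$ is a covering of $X\cup Y$, then there are cofinally many $\tilde Y$ below $\beta$ such that $X\cup\tilde Y$ is a covering of $X\cup Y$. (Down, written $\alpha\leq_2\downarrow\beta$) For all finite $X\subseteq\alpha$ and finite $Y\subseteq[\alpha,\beta)$ with $X\cup Y$ closed there is a finite $\tilde Y\subseteq\alpha$ with $X<\tilde Y$ such that $X\cup\tilde Y$ is a covering of $X\cup Y$ and, for every $i$ less than the cardinality of $Y$, if the $i$-th element of $Y$ is $\leq_1\beta$ then the $i$-th element of $\tilde Y$ is $\leq_1\alpha$. $\alpha<_k\beta$ means $\alpha\leq_k\beta$ and $\alpha\neq\beta$. For classes $A,B$ of ordinals, $A\cong B$ means there is an order-preserving bijection $h:A\to B$ such that for all $x,y\in A$: $f_\xi(x)=y$ iff $f_\xi(h(x))=h(y)$ for every $\xi<\rho$, and $x\leq_k y$ iff $h(x)\leq_k h(y)$ for $k=1,2$. $(\kappa_\alpha)_{\alpha<\theta_1}$ is the increasing enumeration of all ordinals which are minimal with respect to $\leq_1$ (those $\kappa$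 with no $\xi<_1\kappa$); $\theta_1$ is an ordinal, or $\infty$ if there is a proper class of them (every ordinal is $<\infty$). For $\alpha<\theta_1$, $I_\alpha=\{\beta:\kappa_\alpha\leq_1\beta\}$. *)

theory Defs
  imports Main "HOL-Library.Extended"
begin

section \<open>The ordinals\<close>

text \<open>
  HOL has no type of all ordinals.  A type of class \<open>ordinals\<close> plays the role of the class
  \<open>ORD\<close>: it is well-ordered, it satisfies replacement (the values of any function on the
  ordinals below an ordinal are bounded by an ordinal), and it goes beyond the finite
  ordinals.  Equivalently, its order type is a regular uncountable cardinal.  Statements about
  \<open>ORD\<close> are stated for an arbitrary such type; the elements of the type are the ordinals,
  its bounded subsets are the sets of ordinals, and its unbounded subsets are the proper classes.
  The type constructor \<open>hartogs\<close> at the end of this theory provides instances of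
  unboundedly large cardinality.
\<close>

class ordinals = wellorder +
  assumes replacement: "\<exists>b. \<forall>y<x. f y < (b :: 'a)"
    and infinity: "\<exists>w :: 'a. infinite {..<w}"

definition ozero :: "'a::ordinals" ("\<zero>")
  where "\<zero> = (LEAST x. True)"

definition oone :: "'a::ordinals" ("\<one>")
  where "\<one> = (LEAST x. \<zero> < x)"

text \<open>
  Ordinal arithmetic by transfinite recursion on the right argument, with the zero, successor and
  limit cases merged: \<open>\<alpha> + \<beta>\<close> is the least ordinal that is at least \<open>\<alpha>\<close> and exceeds all
  \<open>\<alpha> + \<delta>\<close> with \<open>\<delta> < \<beta>\<close>, and \<open>\<alpha> \<cdot> \<beta>\<close> is the supremum of all \<open>\<alpha> \<cdot> \<delta> + \<alpha>\<close> with \<open>\<delta> < \<beta>\<close>.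
  These ordinals exist by replacement.
\<close>

function oadd :: "'a::ordinals \<Rightarrow> 'a \<Rightarrow> 'a" (infixl "\<oplus>" 65)
  where "\<alpha> \<oplus> \<beta> = (LEAST \<gamma>. \<alpha> \<le> \<gamma> \<and> (\<forall>\<delta>\<in>{..<\<beta>}. \<alpha> \<oplus> \<delta> < \<gamma>))"
  by pat_completeness auto
termination by (relation "inv_image {(x, y). x < y} snd") (auto intro: wf)

declare oadd.simps [simp del]

function omult :: "'a::ordinals \<Rightarrow> 'a \<Rightarrow> 'a" (infixl "\<otimes>" 70)
  where "\<alpha> \<otimes> \<beta> = (LEAST \<gamma>. \<forall>\<delta>\<in>{..<\<beta>}. \<alpha> \<otimes> \<delta> \<oplus> \<alpha> \<le> \<gamma>)"
  by pat_completeness auto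
termination by (relation "inv_image {(x, y). x < y} snd") (auto intro: wf)

declare omult.simps [simp del]

definition additively_indecomposable :: "'a::ordinals \<Rightarrow> bool"
  where "additively_indecomposable \<rho> \<longleftrightarrow> \<rho> \<noteq> \<zero> \<and> (\<forall>x<\<rho>. \<forall>y<\<rho>. x \<oplus> y < \<rho>)"

definition divisible_by :: "'a::ordinals \<Rightarrow> 'a \<Rightarrow> bool"
  where "divisible_by \<beta> \<alpha> \<longleftrightarrow> (\<exists>\<delta>. \<beta> = \<alpha> \<otimes> \<delta>)"


section \<open>Closed sets and coverings\<close>

definition f_xi :: "'a::ordinals \<Rightarrow> 'a \<Rightarrow> 'a \<Rightarrow> 'a"
  where "f_xi \<rho> \<xi> x =
    (if divisible_by x \<rho> then x \<oplus> \<xi>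
     else (THE y. \<exists>\<zeta> \<epsilon>. \<zero> < \<epsilon> \<and> \<epsilon> < \<rho> \<and> x = \<rho> \<otimes> \<zeta> \<oplus> \<epsilon> \<and> y = \<rho> \<otimes> \<zeta>))"

definition rho_closed :: "'a::ordinals \<Rightarrow> 'a set \<Rightarrow> bool"
  where "rho_closed \<rho> X \<longleftrightarrow>
    (\<forall>\<sigma>. divisible_by \<sigma> \<rho> \<and> (\<exists>\<xi><\<rho>. \<sigma> \<oplus> \<xi> \<in> X) \<longrightarrow> \<sigma> \<in> X)"

definition set_less :: "'a::ordinals set \<Rightarrow> 'a set \<Rightarrow> bool"
  where "set_less X Y \<longleftrightarrow> (\<forall>x\<in>X. \<forall>y\<in>Y. x < y)"

text \<open>
  Coverings, and the defining clauses of \<open>\<le>\<^sub>1\<close> and \<open>\<le>\<^sub>2\<close>, take the two relations as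
  parameters \<open>R1\<close> and \<open>R2\<close>, so that they can be used inside the recursion that defines
  these relations.  \<open>is_covering \<rho> R1 R2 Z X\<close> says that \<open>Z\<close> is a covering of \<open>X\<close>.
\<close>

definition covering_map ::
    "'a::ordinals \<Rightarrow> ('a \<Rightarrow> 'a \<Rightarrow> bool) \<Rightarrow> ('a \<Rightarrow> 'a \<Rightarrow> bool) \<Rightarrow> ('a \<Rightarrow> 'a) \<Rightarrow> 'a set \<Rightarrow> bool"
  where "covering_map \<rho> R1 R2 h X \<longleftrightarrow>
    strict_mono_on X h \<and>
    (\<forall>\<xi><\<rho>. \<forall>x\<in>X. \<forall>y\<in>X. f_xi \<rho> \<xi> x = y \<longleftrightarrow> f_xi \<rho> \<xi> (h x) = h y) \<and>
    (\<forall>x\<in>X. \<forall>y\<in>X. R1 x y \<longrightarrow> R1 (h x) (h y)) \<and>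
    (\<forall>x\<in>X. \<forall>y\<in>X. R2 x y \<longrightarrow> R2 (h x) (h y))"

definition is_covering ::
    "'a::ordinals \<Rightarrow> ('a \<Rightarrow> 'a \<Rightarrow> bool) \<Rightarrow> ('a \<Rightarrow> 'a \<Rightarrow> bool) \<Rightarrow> 'a set \<Rightarrow> 'a set \<Rightarrow> bool"
  where "is_covering \<rho> R1 R2 Z X \<longleftrightarrow>
    rho_closed \<rho> X \<and> (\<exists>h. covering_map \<rho> R1 R2 h X \<and> Z = h ` X)"

definition cofinal_coverings ::
    "'a::ordinals \<Rightarrow> ('a \<Rightarrow> 'a \<Rightarrow> bool) \<Rightarrow> ('a \<Rightarrow> 'a \<Rightarrow> bool) \<Rightarrow> 'a set \<Rightarrow> 'a set \<Rightarrow> 'a \<Rightarrow> bool"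
  where "cofinal_coverings \<rho> R1 R2 X Y \<alpha> \<longleftrightarrow>
    (\<forall>\<gamma><\<alpha>. \<exists>Y'. finite Y' \<and> Y' \<subseteq> {\<gamma><..<\<alpha>} \<and> is_covering \<rho> R1 R2 (X \<union> Y') (X \<union> Y))"


section \<open>The relations \<open>\<le>\<^sub>1\<close> and \<open>\<le>\<^sub>2\<close>\<close>

definition le1_clause ::
    "'a::ordinals \<Rightarrow> ('a \<Rightarrow> 'a \<Rightarrow> bool) \<Rightarrow> ('a \<Rightarrow> 'a \<Rightarrow> bool) \<Rightarrow> 'a \<Rightarrow> 'a \<Rightarrow> bool"
  where "le1_clause \<rho> R1 R2 \<alpha> \<beta> \<longleftrightarrow>
    \<alpha> \<le> \<beta> \<and>
    (\<forall>X Y. finite X \<and> X \<subseteq> {..<\<alpha>} \<and> finite Y \<and> Y \<subseteq> {\<alpha>..<\<beta>} \<and> rho_closed \<rho> (X \<union> Y) \<longrightarrow>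
      (\<exists>Y'. finite Y' \<and> Y' \<subseteq> {..<\<alpha>} \<and> set_less X Y' \<and>
            is_covering \<rho> R1 R2 (X \<union> Y') (X \<union> Y)))"

definition le2_up_clause ::
    "'a::ordinals \<Rightarrow> ('a \<Rightarrow> 'a \<Rightarrow> bool) \<Rightarrow> ('a \<Rightarrow> 'a \<Rightarrow> bool) \<Rightarrow> 'a \<Rightarrow> 'a \<Rightarrow> bool"
  where "le2_up_clause \<rho> R1 R2 \<alpha> \<beta> \<longleftrightarrow>
    (\<forall>X Y. finite X \<and> X \<subseteq> {..<\<alpha>} \<and> finite Y \<and> Y \<subseteq> {..<\<alpha>} \<and>
           rho_closed \<rho> (X \<union> Y) \<and> set_less X Y \<longrightarrow>
      cofinal_coverings \<rho> R1 R2 X Y \<alpha> \<longrightarrow> cofinal_coverings \<rho> R1 R2 X Y \<beta>)"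

definition le2_down_clause ::
    "'a::ordinals \<Rightarrow> ('a \<Rightarrow> 'a \<Rightarrow> bool) \<Rightarrow> ('a \<Rightarrow> 'a \<Rightarrow> bool) \<Rightarrow> 'a \<Rightarrow> 'a \<Rightarrow> bool"
  where "le2_down_clause \<rho> R1 R2 \<alpha> \<beta> \<longleftrightarrow>
    (\<forall>X Y. finite X \<and> X \<subseteq> {..<\<alpha>} \<and> finite Y \<and> Y \<subseteq> {\<alpha>..<\<beta>} \<and> rho_closed \<rho> (X \<union> Y) \<longrightarrow>
      (\<exists>Y'. finite Y' \<and> Y' \<subseteq> {..<\<alpha>} \<and> set_less X Y' \<and>
            is_covering \<rho> R1 R2 (X \<union> Y') (X \<union> Y) \<and>
            (\<forall>i<card Y. R1 (sorted_list_of_set Y ! i) \<beta> \<longrightarrow>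
                        R1 (sorted_list_of_set Y' ! i) \<alpha>)))"

definition le2_clause ::
    "'a::ordinals \<Rightarrow> ('a \<Rightarrow> 'a \<Rightarrow> bool) \<Rightarrow> ('a \<Rightarrow> 'a \<Rightarrow> bool) \<Rightarrow> 'a \<Rightarrow> 'a \<Rightarrow> bool"
  where "le2_clause \<rho> R1 R2 \<alpha> \<beta> \<longleftrightarrow>
    \<alpha> \<le> \<beta> \<and> le2_up_clause \<rho> R1 R2 \<alpha> \<beta> \<and> le2_down_clause \<rho> R1 R2 \<alpha> \<beta>"

text \<open>
  \<open>le_preds \<rho> \<beta>\<close> is the pair \<open>({\<alpha>. \<alpha> \<le>\<^sub>1 \<beta>}, {\<alpha>. \<alpha> \<le>\<^sub>2 \<beta>})\<close>.  The clause for \<open>\<alpha> \<le>\<^sub>1 \<beta>\<close>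
  only uses the relations with larger argument below \<open>\<beta>\<close>; the clause for \<open>\<alpha> \<le>\<^sub>2 \<beta>\<close> also
  uses \<open>\<le>\<^sub>1\<close> at \<open>\<beta>\<close> itself, which at that stage has already been determined.  The
  equivalences \<open>le1_iff\<close> and \<open>le2_iff\<close> below eliminate these restrictions.
\<close>

context notes conj_cong [fundef_cong]
begin

function le_preds :: "'a::ordinals \<Rightarrow> 'a \<Rightarrow> 'a set \<times> 'a set"
  where "le_preds \<rho> \<beta> =
    (let R1 = (\<lambda>x y. y < \<beta> \<and> x \<in> fst (le_preds \<rho> y));
         R2 = (\<lambda>x y. y < \<beta> \<and> x \<in> snd (le_preds \<rho> y));
         P1 = {\<alpha>. le1_clause \<rho> R1 R2 \<alpha> \<beta>};
         P2 = {\<alpha>. le2_clause \<rho> (\<lambda>x y. R1 x y \<or> y = \<beta> \<and> x \<in> P1) R2 \<alpha> \<beta>}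
     in (P1, P2))"
  by pat_completeness auto
termination by (relation "inv_image {(x, y). x < y} snd") (auto intro: wf)

end

declare le_preds.simps [simp del]

definition le1 :: "'a::ordinals \<Rightarrow> 'a \<Rightarrow> 'a \<Rightarrow> bool"
  where "le1 \<rho> \<alpha> \<beta> \<longleftrightarrow> \<alpha> \<in> fst (le_preds \<rho> \<beta>)"

definition le2 :: "'a::ordinals \<Rightarrow> 'a \<Rightarrow> 'a \<Rightarrow> bool"
  where "le2 \<rho> \<alpha> \<beta> \<longleftrightarrow> \<alpha> \<in> snd (le_preds \<rho> \<beta>)"

definition less1 :: "'a::ordinals \<Rightarrow> 'a \<Rightarrow> 'a \<Rightarrow> bool"
  where "less1 \<rho> \<alpha> \<beta> \<longleftrightarrow> le1 \<rho> \<alpha> \<beta> \<and> \<alpha> \<noteq> \<beta>"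

lemma is_covering_cong:
  assumes "Z \<subseteq> {..<\<beta>}" "X \<subseteq> {..<\<beta>}"
    and "\<And>x y. y < \<beta> \<Longrightarrow> R1 x y = S1 x y" "\<And>x y. y < \<beta> \<Longrightarrow> R2 x y = S2 x y"
  shows "is_covering \<rho> R1 R2 Z X = is_covering \<rho> S1 S2 Z X"
proof -
  have "covering_map \<rho> R1 R2 h X = covering_map \<rho> S1 S2 h X" if "Z = h ` X" for h
  proof -
    have "h x < \<beta>" "x < \<beta>" if "x \<in> X" for x
      using that assms(1,2) \<open>Z = h ` X\<close> by auto
    then show ?thesis
      unfolding covering_map_def by (simp add: assms(3,4))
  qed
  then show ?thesis unfolding is_covering_def by blast
qed

lemma cofinal_coverings_cong:
  assumes "X \<union> Y \<subseteq> {..<\<beta>}" "\<alpha> \<le> \<beta>"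
    and "\<And>x y. y < \<beta> \<Longrightarrow> R1 x y = S1 x y" "\<And>x y. y < \<beta> \<Longrightarrow> R2 x y = S2 x y"
  shows "cofinal_coverings \<rho> R1 R2 X Y \<alpha> = cofinal_coverings \<rho> S1 S2 X Y \<alpha>"
proof -
  have *: "is_covering \<rho> R1 R2 (X \<union> Y') (X \<union> Y) = is_covering \<rho> S1 S2 (X \<union> Y') (X \<union> Y)"
    if "Y' \<subseteq> {\<gamma><..<\<alpha>}" for Y' \<gamma>
  proof (rule is_covering_cong[where \<beta> = \<beta>])
    have "Y' \<subseteq> {..<\<beta>}"
      using that assms(2) by (meson greaterThanLessThan_iff lessThan_iff order_less_le_trans subset_iff)
    then show "X \<union> Y' \<subseteq> {..<\<beta>}" "X \<union> Y \<subseteq> {..<\<beta>}" using assms(1) by auto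
  qed (simp_all add: assms(3,4))
  show ?thesis
    unfolding cofinal_coverings_def
    by (intro all_cong1 imp_cong ex_cong1 conj_cong refl) (rule *)
qed

lemma le1_clause_cong:
  assumes R: "\<And>x y. y < \<beta> \<Longrightarrow> R1 x y = S1 x y" "\<And>x y. y < \<beta> \<Longrightarrow> R2 x y = S2 x y"
  shows "le1_clause \<rho> R1 R2 \<alpha> \<beta> = le1_clause \<rho> S1 S2 \<alpha> \<beta>"
proof (cases "\<alpha> \<le> \<beta>")
  case True
  have 1: "is_covering \<rho> R1 R2 (X \<union> Y') (X \<union> Y) = is_covering \<rho> S1 S2 (X \<union> Y') (X \<union> Y)"
    if "X \<subseteq> {..<\<alpha>}" "Y \<subseteq> {\<alpha>..<\<beta>}" "Y' \<subseteq> {..<\<alpha>}" for X Y Y'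
  proof (rule is_covering_cong[where \<beta> = \<beta>])
    have "{..<\<alpha>} \<subseteq> {..<\<beta>}" "{\<alpha>..<\<beta>} \<subseteq> {..<\<beta>}" using True by auto
    then have "X \<subseteq> {..<\<beta>}" "Y \<subseteq> {..<\<beta>}" "Y' \<subseteq> {..<\<beta>}"
      using that by (metis subset_trans)+
    then show "X \<union> Y' \<subseteq> {..<\<beta>}" "X \<union> Y \<subseteq> {..<\<beta>}" by simp_all
  qed (simp_all add: R)
  show ?thesis
    unfolding le1_clause_def
    by (intro all_cong1 imp_cong ex_cong1 conj_cong refl) (rule 1; simp)
qed (simp add: le1_clause_def)

lemma le2_clause_cong:
  assumes R1: "\<And>x y. y \<le> \<beta> \<Longrightarrow> R1 x y = S1 x y" and R2: "\<And>x y. y < \<beta> \<Longrightarrow> R2 x y = S2 x y"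
  shows "le2_clause \<rho> R1 R2 \<alpha> \<beta> = le2_clause \<rho> S1 S2 \<alpha> \<beta>"
proof (cases "\<alpha> \<le> \<beta>")
  case True
  have 1: "is_covering \<rho> R1 R2 (X \<union> Y') (X \<union> Y) = is_covering \<rho> S1 S2 (X \<union> Y') (X \<union> Y)"
    if "X \<subseteq> {..<\<alpha>}" "Y \<subseteq> {\<alpha>..<\<beta>}" "Y' \<subseteq> {..<\<alpha>}" for X Y Y'
  proof (rule is_covering_cong[where \<beta> = \<beta>])
    have "{..<\<alpha>} \<subseteq> {..<\<beta>}" "{\<alpha>..<\<beta>} \<subseteq> {..<\<beta>}" using True by auto
    then have "X \<subseteq> {..<\<beta>}" "Y \<subseteq> {..<\<beta>}" "Y' \<subseteq> {..<\<beta>}"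
      using that by (metis subset_trans)+
    then show "X \<union> Y' \<subseteq> {..<\<beta>}" "X \<union> Y \<subseteq> {..<\<beta>}" by simp_all
  qed (simp_all add: R1 R2)
  have 2: "R1 x \<beta> = S1 x \<beta>" "R1 x \<alpha> = S1 x \<alpha>" for x
    using R1 True by auto
  have 3: "cofinal_coverings \<rho> R1 R2 X Y \<alpha> = cofinal_coverings \<rho> S1 S2 X Y \<alpha>"
    "cofinal_coverings \<rho> R1 R2 X Y \<beta> = cofinal_coverings \<rho> S1 S2 X Y \<beta>"
    if "X \<subseteq> {..<\<alpha>}" "Y \<subseteq> {..<\<alpha>}" for X Y
  proof -
    have "{..<\<alpha>} \<subseteq> {..<\<beta>}" using True by auto
    then have *: "X \<union> Y \<subseteq> {..<\<beta>}" using that by (metis subset_trans Un_least)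
    show "cofinal_coverings \<rho> R1 R2 X Y \<alpha> = cofinal_coverings \<rho> S1 S2 X Y \<alpha>"
      using * True by (rule cofinal_coverings_cong) (simp_all add: R1 R2)
    show "cofinal_coverings \<rho> R1 R2 X Y \<beta> = cofinal_coverings \<rho> S1 S2 X Y \<beta>"
      using * order.refl by (rule cofinal_coverings_cong) (simp_all add: R1 R2)
  qed
  have "le2_up_clause \<rho> R1 R2 \<alpha> \<beta> = le2_up_clause \<rho> S1 S2 \<alpha> \<beta>"
    unfolding le2_up_clause_def
    by (intro all_cong1 imp_cong ex_cong1 conj_cong refl) (rule 3; simp)+
  moreover have "le2_down_clause \<rho> R1 R2 \<alpha> \<beta> = le2_down_clause \<rho> S1 S2 \<alpha> \<beta>"
    unfolding le2_down_clause_def 2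
    by (intro all_cong1 imp_cong ex_cong1 conj_cong refl) (rule 1; simp)
  ultimately show ?thesis by (simp add: le2_clause_def)
qed (simp add: le2_clause_def)

theorem le1_iff: "le1 \<rho> \<alpha> \<beta> \<longleftrightarrow> le1_clause \<rho> (le1 \<rho>) (le2 \<rho>) \<alpha> \<beta>"
proof -
  have "le1 \<rho> \<alpha> \<beta> \<longleftrightarrow> le1_clause \<rho> (\<lambda>x y. y < \<beta> \<and> le1 \<rho> x y) (\<lambda>x y. y < \<beta> \<and> le2 \<rho> x y) \<alpha> \<beta>"
    unfolding le1_def le2_def by (subst le_preds.simps) (simp add: Let_def)
  then show ?thesis
    using le1_clause_cong[of \<beta> "\<lambda>x y. y < \<beta> \<and> le1 \<rho> x y" "le1 \<rho>"
        "\<lambda>x y. y < \<beta> \<and> le2 \<rho> x y" "le2 \<rho>" \<rho> \<alpha>] by simp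
qed

theorem le2_iff: "le2 \<rho> \<alpha> \<beta> \<longleftrightarrow> le2_clause \<rho> (le1 \<rho>) (le2 \<rho>) \<alpha> \<beta>"
proof -
  define S where "S = (\<lambda>x y. y < \<beta> \<and> le1 \<rho> x y \<or> y = \<beta> \<and>
    le1_clause \<rho> (\<lambda>x y. y < \<beta> \<and> le1 \<rho> x y) (\<lambda>x y. y < \<beta> \<and> le2 \<rho> x y) x \<beta>)"
  have eq: "le1 \<rho> x \<beta> \<longleftrightarrow> le1_clause \<rho> (\<lambda>x y. y < \<beta> \<and> le1 \<rho> x y) (\<lambda>x y. y < \<beta> \<and> le2 \<rho> x y) x \<beta>" for x
    unfolding le1_def le2_def by (subst le_preds.simps) (simp add: Let_def)
  have "le2 \<rho> \<alpha> \<beta> \<longleftrightarrow> le2_clause \<rho> S (\<lambda>x y. y < \<beta> \<and> le2 \<rho> x y) \<alpha> \<beta>"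
    unfolding S_def le1_def le2_def by (subst le_preds.simps) (simp add: Let_def)
  moreover have "S x y = le1 \<rho> x y" if "y \<le> \<beta>" for x y
    using that eq[of x] unfolding S_def by (cases "y = \<beta>") auto
  ultimately show ?thesis
    using le2_clause_cong[of \<beta> S "le1 \<rho>" "\<lambda>x y. y < \<beta> \<and> le2 \<rho> x y" "le2 \<rho>" \<rho> \<alpha>] by simp
qed

definition pattern_iso :: "'a::ordinals \<Rightarrow> 'a set \<Rightarrow> 'a set \<Rightarrow> bool"
  where "pattern_iso \<rho> A B \<longleftrightarrow>
    (\<exists>h. bij_betw h A B \<and> strict_mono_on A h \<and>
      (\<forall>\<xi><\<rho>. \<forall>x\<in>A. \<forall>y\<in>A. f_xi \<rho> \<xi> x = y \<longleftrightarrow> f_xi \<rho> \<xi> (h x) = h y) \<and>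
      (\<forall>x\<in>A. \<forall>y\<in>A. le1 \<rho> x y \<longleftrightarrow> le1 \<rho> (h x) (h y)) \<and>
      (\<forall>x\<in>A. \<forall>y\<in>A. le2 \<rho> x y \<longleftrightarrow> le2 \<rho> (h x) (h y)))"


section \<open>The \<open>\<le>\<^sub>1\<close>-minimal ordinals\<close>

definition le1_minimal :: "'a::ordinals \<Rightarrow> 'a set"
  where "le1_minimal \<rho> = {\<kappa>. \<not> (\<exists>\<xi>. less1 \<rho> \<xi> \<kappa>)}"

definition increasing_enum :: "('a::ordinals \<Rightarrow> 'a) \<Rightarrow> 'a set \<Rightarrow> 'a set \<Rightarrow> bool"
  where "increasing_enum e D K \<longleftrightarrow> strict_mono_on D e \<and> e ` D = K"

text \<open>
  \<open>theta1 \<rho>\<close> is the length of the enumeration of the \<open>\<le>\<^sub>1\<close>-minimal ordinals: \<open>Fin \<theta>\<close> if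
  they are enumerated by the ordinals below \<open>\<theta>\<close>, and \<open>Pinf\<close> if there is no such ordinal,
  i.e. if they form a proper class.  \<open>kappa \<rho>\<close> is meaningful only on arguments below
  \<open>theta1 \<rho>\<close>; there it is the enumeration, which exists by \<open>kappa_increasing_enum\<close>.
\<close>

definition theta1 :: "'a::ordinals \<Rightarrow> 'a extended"
  where "theta1 \<rho> =
    (if \<exists>\<theta> e. increasing_enum e {..<\<theta>} (le1_minimal \<rho>)
     then Fin (THE \<theta>. \<exists>e. increasing_enum e {..<\<theta>} (le1_minimal \<rho>)) else Pinf)"

definition kappa :: "'a::ordinals \<Rightarrow> 'a \<Rightarrow> 'a"
  where "kappa \<rho> = (SOME e. increasing_enum e {\<alpha>. Fin \<alpha> < theta1 \<rho>} (le1_minimal \<rho>))"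

definition I_set :: "'a::ordinals \<Rightarrow> 'a \<Rightarrow> 'a set"
  where "I_set \<rho> \<alpha> = {\<beta>. le1 \<rho> (kappa \<rho> \<alpha>) \<beta>}"

lemma strict_mono_on_ge:
  fixes e :: "'a::ordinals \<Rightarrow> 'a"
  assumes "strict_mono_on D e" "\<And>x y. x \<in> D \<Longrightarrow> y < x \<Longrightarrow> y \<in> D"
  shows "x \<in> D \<Longrightarrow> x \<le> e x"
proof (induction x rule: less_induct)
  case (less x)
  show ?case
  proof (rule ccontr)
    assume "\<not> x \<le> e x"
    then have "e x < x" by simp
    then have "e x \<in> D" "e (e x) < e x"
      using assms less.prems by (auto simp: strict_mono_on_def)
    then show False using less.IH[OF \<open>e x < x\<close>] by simp
  qed
qed

lemma increasing_enum_not_lt: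
  assumes e: "strict_mono_on D e" "e ` D = K" "\<And>x y. x \<in> D \<Longrightarrow> y < x \<Longrightarrow> y \<in> D"
    and e': "increasing_enum e' {..<\<theta>} K"
  shows "(\<theta> :: 'a::ordinals) \<notin> D"
proof
  assume \<theta>: "\<theta> \<in> D"
  have "\<exists>y. y < \<theta> \<and> e' y = e x" if "x \<in> D" for x
  proof -
    have "e x \<in> e' ` {..<\<theta>}" using e' e(2) that unfolding increasing_enum_def by blast
    then show ?thesis by force
  qed
  then obtain g where g: "\<And>x. x \<in> D \<Longrightarrow> g x < \<theta> \<and> e' (g x) = e x" by metis
  have "strict_mono_on D g"
  proof (rule strict_mono_onI)
    fix x y assume xy: "x \<in> D" "y \<in> D" "x < y"
    then have "e' (g x) < e' (g y)"
      using g e(1) by (auto simp: strict_mono_on_def)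
    then show "g x < g y"
      using strict_mono_on_less[of "{..<\<theta>}" e' "g x" "g y"] g xy e'
      by (auto simp: increasing_enum_def)
  qed
  then have "\<theta> \<le> g \<theta>" using e(3) \<theta> by (rule strict_mono_on_ge)
  then show False using g[OF \<theta>] by (meson leD)
qed

lemma increasing_enum_le:
  assumes "increasing_enum e {..<\<theta>} K" "increasing_enum e' {..<\<theta>'} K"
  shows "\<theta> \<le> (\<theta>' :: 'a::ordinals)"
  using increasing_enum_not_lt[of "{..<\<theta>}" e K e' \<theta>'] assms
  by (force simp: increasing_enum_def)

theorem kappa_increasing_enum:
  fixes \<rho> :: "'a::ordinals"
  shows "increasing_enum (kappa \<rho>) {\<alpha>. Fin \<alpha> < theta1 \<rho>} (le1_minimal \<rho>)"
proof -
  define K where "K = le1_minimal \<rho>"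
  define e :: "'a \<Rightarrow> 'a"
    where "e = wfrec {(x, y). x < y} (\<lambda>e \<alpha>. LEAST k. k \<in> K \<and> (\<forall>\<gamma><\<alpha>. e \<gamma> < k))"
  have e: "e \<alpha> = (LEAST k. k \<in> K \<and> (\<forall>\<gamma><\<alpha>. e \<gamma> < k))" for \<alpha>
    using wfrec[OF wf, of "\<lambda>e \<alpha>. LEAST k. k \<in> K \<and> (\<forall>\<gamma><\<alpha>. e \<gamma> < k)" \<alpha>]
    unfolding e_def[symmetric] by (simp add: cut_def)
  define D where "D = {\<alpha>. \<exists>k\<in>K. \<forall>\<gamma><\<alpha>. e \<gamma> < k}"
  have eD: "e \<alpha> \<in> K \<and> (\<forall>\<gamma><\<alpha>. e \<gamma> < e \<alpha>)" if "\<alpha> \<in> D" for \<alpha>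
  proof -
    from that obtain k where "k \<in> K \<and> (\<forall>\<gamma><\<alpha>. e \<gamma> < k)" unfolding D_def by blast
    then have "(LEAST k. k \<in> K \<and> (\<forall>\<gamma><\<alpha>. e \<gamma> < k)) \<in> K \<and>
        (\<forall>\<gamma><\<alpha>. e \<gamma> < (LEAST k. k \<in> K \<and> (\<forall>\<gamma><\<alpha>. e \<gamma> < k)))" by (rule LeastI)
    then show ?thesis using e[of \<alpha>] by simp
  qed
  have mono: "strict_mono_on D e"
    using eD by (auto intro!: strict_mono_onI)
  have down: "y \<in> D" if "x \<in> D" "y < x" for x y
    using that unfolding D_def by (auto intro: order.strict_trans)
  have surj: "k \<in> e ` D" if "k \<in> K" for k
  proof (rule ccontr)
    assume k: "k \<notin> e ` D"
    have *: "\<alpha> \<in> D \<and> e \<alpha> < k" for \<alpha>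
    proof (induction \<alpha> rule: less_induct)
      case (less \<alpha>)
      then have "\<alpha> \<in> D" using \<open>k \<in> K\<close> unfolding D_def by blast
      moreover have "e \<alpha> \<le> k"
        unfolding e[of \<alpha>] by (rule Least_le) (use less \<open>k \<in> K\<close> in auto)
      ultimately show ?case using k by (metis image_eqI order_le_less)
    qed
    then show False using strict_mono_on_ge[OF mono, of k] down *[of k] by (meson leD)
  qed
  have enum: "increasing_enum e D K"
    unfolding increasing_enum_def using mono surj eD by auto
  have "D = {\<alpha>. Fin \<alpha> < theta1 \<rho>}"
  proof (cases "D = UNIV")
    case True
    have "\<not> increasing_enum e' {..<\<theta>} K" for e' \<theta>
      using increasing_enum_not_lt[of D e K e' \<theta>] enum True by (auto simp: increasing_enum_def)
    then show ?thesis using True by (simp add: theta1_def K_def)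
  next
    case False
    define \<theta> where "\<theta> = (LEAST x. x \<notin> D)"
    have "\<exists>x. x \<notin> D" using False by blast
    then have "\<theta> \<notin> D" unfolding \<theta>_def by (rule LeastI_ex)
    moreover have "x \<in> D" if "x < \<theta>" for x using that not_less_Least unfolding \<theta>_def by blast
    ultimately have D: "D = {..<\<theta>}" using down by (metis lessThan_iff linorder_cases subsetI subset_antisym)
    then have ex: "increasing_enum e {..<\<theta>} K" using enum by simp
    then have "(THE \<theta>. \<exists>e. increasing_enum e {..<\<theta>} K) = \<theta>"
      by (intro the_equality) (auto intro: order.antisym increasing_enum_le)
    then have "theta1 \<rho> = Fin \<theta>" using ex unfolding theta1_def K_def[symmetric] by auto
    then show ?thesis by (simp add: D lessThan_def)
  qed
  then show ?thesis using enum unfolding K_def kappa_def by (metis someI)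
qed


section \<open>Instances of class \<open>ordinals\<close>\<close>

text \<open>The least cardinal greater than the cardinality of \<open>'b + nat\<close>.\<close>

abbreviation (input) hartogs_rel :: "('b + nat) set rel"
  where "hartogs_rel \<equiv> cardSuc (card_of (UNIV :: ('b + nat) set))"

lemma hartogs_infinite: "infinite (Field (hartogs_rel :: ('b + nat) set rel))"
  by (simp add: card_of_cardSuc_finite)

typedef 'b hartogs = "Field (hartogs_rel :: ('b + nat) set rel)"
  using hartogs_infinite by (metis finite.emptyI ex_in_conv)

lemma hartogs_well_order: "well_order_on (Field hartogs_rel) (hartogs_rel :: ('b + nat) set rel)"
  using cardSuc_Card_order[OF card_of_Card_order] unfolding card_order_on_def by blast

instantiation hartogs :: (type) wellorder
begin

definition less_eq_hartogs :: "'a hartogs \<Rightarrow> 'a hartogs \<Rightarrow> bool"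
  where "x \<le> y \<longleftrightarrow> (Rep_hartogs x, Rep_hartogs y) \<in> hartogs_rel"

definition less_hartogs :: "'a hartogs \<Rightarrow> 'a hartogs \<Rightarrow> bool"
  where "x < y \<longleftrightarrow> x \<le> y \<and> \<not> y \<le> (x :: 'a hartogs)"

instance
proof
  let ?r = "hartogs_rel :: ('a + nat) set rel"
  have lin: "refl_on (Field ?r) ?r" "trans ?r" "antisym ?r" "total_on (Field ?r) ?r" "wf (?r - Id)"
    using hartogs_well_order[where 'b = 'a]
    unfolding well_order_on_def linear_order_on_def partial_order_on_def preorder_on_def by auto
  have refl: "x \<le> x" for x :: "'a hartogs"
    unfolding less_eq_hartogs_def using lin(1) Rep_hartogs by (auto simp: refl_on_def)
  have antisym: "x = y" if "x \<le> y" "y \<le> x" for x y :: "'a hartogs"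
    using that lin(3) unfolding less_eq_hartogs_def by (metis antisymD Rep_hartogs_inject)
  fix x y z :: "'a hartogs"
  show "x < y \<longleftrightarrow> x \<le> y \<and> \<not> y \<le> x" by (rule less_hartogs_def)
  show "x \<le> x" by (rule refl)
  show "x \<le> z" if "x \<le> y" "y \<le> z"
    using that lin(2) unfolding less_eq_hartogs_def by (metis transD)
  show "x = y" if "x \<le> y" "y \<le> x" using that by (rule antisym)
  show "x \<le> y \<or> y \<le> x"
    using lin(4) refl[of x] Rep_hartogs[of x] Rep_hartogs[of y]
    unfolding less_eq_hartogs_def total_on_def by metis
  fix P :: "'a hartogs \<Rightarrow> bool" and a
  assume IH: "\<And>x. (\<And>y. y < x \<Longrightarrow> P y) \<Longrightarrow> P x"
  have "wf (inv_image (?r - Id) Rep_hartogs)" using lin(5) by (rule wf_inv_image)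
  then show "P a"
  proof (induction a rule: wf_induct_rule)
    case (less x)
    have "P y" if "y < x" for y
      by (rule less) (use that refl in \<open>auto simp: less_hartogs_def less_eq_hartogs_def\<close>)
    then show ?case by (rule IH)
  qed
qed

end

lemma hartogs_bounded:
  fixes B :: "'b hartogs set"
  assumes "(card_of B, card_of (UNIV :: ('b + nat) set)) \<in> ordLeq"
  shows "\<exists>b. \<forall>y\<in>B. y < b"
proof -
  let ?r = "hartogs_rel :: ('b + nat) set rel"
  have wo: "refl_on (Field ?r) ?r" "trans ?r"
    using hartogs_well_order[where 'b = 'b]
    unfolding well_order_on_def linear_order_on_def partial_order_on_def preorder_on_def by auto
  have "\<exists>i\<in>Field ?r. Rep_hartogs ` B \<subseteq> {y. (y, i) \<in> ?r}"
  proof (rule cardSuc_UNION)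
    show "relChain ?r (\<lambda>i. {y. (y, i) \<in> ?r})"
      using wo(2) unfolding relChain_def by (auto dest: transD)
    show "Rep_hartogs ` B \<subseteq> (\<Union>i\<in>Field ?r. {y. (y, i) \<in> ?r})"
      using wo(1) Rep_hartogs by (auto simp: refl_on_def)
    show "(card_of (Rep_hartogs ` B), card_of (UNIV :: ('b + nat) set)) \<in> ordLeq"
      using card_of_image assms by (rule ordLeq_transitive)
  qed (use assms card_of_Card_order in \<open>auto simp: Field_card_of\<close>)
  then obtain i where i: "i \<in> Field ?r" "\<And>y. y \<in> B \<Longrightarrow> (Rep_hartogs y, i) \<in> ?r" by blast
  obtain j where j: "j \<in> Field ?r" "i \<noteq> j" "(i, j) \<in> ?r"
    using infinite_Card_order_limit[OF cardSuc_Card_order[OF card_of_Card_order] hartogs_infinite i(1)]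
    by blast
  have "Abs_hartogs i < Abs_hartogs j"
    unfolding order.strict_iff_order less_eq_hartogs_def
    using i(1) j by (simp add: Abs_hartogs_inverse Abs_hartogs_inject)
  moreover have "y \<le> Abs_hartogs i" if "y \<in> B" for y
    unfolding less_eq_hartogs_def using i that by (simp add: Abs_hartogs_inverse)
  ultimately show ?thesis by (metis order.strict_trans1)
qed

instance hartogs :: (type) ordinals
proof
  let ?r = "hartogs_rel :: ('a + nat) set rel"
  let ?U = "card_of (UNIV :: ('a + nat) set)"
  fix x :: "'a hartogs" and f :: "'a hartogs \<Rightarrow> 'a hartogs"
  have "Rep_hartogs ` {..<x} \<subseteq> underS ?r (Rep_hartogs x)"
    by (auto simp: underS_def less_hartogs_def less_eq_hartogs_def Rep_hartogs_inject)
  then have "(card_of (Rep_hartogs ` {..<x}), card_of (underS ?r (Rep_hartogs x))) \<in> ordLeq"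
    by (rule card_of_mono1)
  moreover have "(card_of (underS ?r (Rep_hartogs x)), ?r) \<in> ordLess"
    using card_of_underS[OF cardSuc_Card_order[OF card_of_Card_order] Rep_hartogs] .
  ultimately have "(card_of (Rep_hartogs ` {..<x}), ?r) \<in> ordLess"
    by (rule ordLeq_ordLess_trans)
  then have *: "(card_of (Rep_hartogs ` {..<x}), ?U) \<in> ordLeq"
    using cardSuc_ordLeq_ordLess[OF card_of_Card_order card_of_Card_order] by blast
  have "f ` {..<x} = (f \<circ> Abs_hartogs) ` (Rep_hartogs ` {..<x})"
    by (simp add: image_comp comp_def Rep_hartogs_inverse)
  then have "(card_of (f ` {..<x}), card_of (Rep_hartogs ` {..<x})) \<in> ordLeq"
    by (metis card_of_image)
  then show "\<exists>b. \<forall>y<x. f y < b"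
    using hartogs_bounded[of "f ` {..<x}"] * by (metis ordLeq_transitive image_eqI lessThan_iff)
next
  have "infinite (UNIV :: 'a hartogs set)"
    using hartogs_infinite[where 'b = 'a] type_definition.Rep_range[OF type_definition_hartogs]
    by (metis finite_imageI)
  then obtain g :: "nat \<Rightarrow> 'a hartogs" where g: "inj g"
    using infinite_countable_subset by blast
  have "(card_of (range g), card_of (UNIV :: nat set)) \<in> ordLeq" by (rule card_of_image)
  moreover have "(card_of (UNIV :: nat set), card_of (UNIV :: ('a + nat) set)) \<in> ordLeq"
    by (rule card_of_ordLeqI[of Inr]) (auto simp: inj_on_def)
  ultimately obtain b where "\<forall>y\<in>range g. y < b"
    using hartogs_bounded ordLeq_transitive by blast
  then have "range g \<subseteq> {..<b}" by auto
  then have "infinite {..<b}"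
    using finite_subset[of "range g" "{..<b}"] finite_imageD[OF _ g] infinite_UNIV_nat by blast
  then show "\<exists>w :: 'a hartogs. infinite {..<w}" by blast
qed

end

(*
  Since only finite sets are reflected, the minimal element following kappa_alpha is a successor
  gamma + 1.  The translation x |-> gamma + x of the ordinals x > 0 preserves and reflects <=_1
  and <=_2: nothing at or below gamma is <=_1 anything above gamma, so in a finite closed set the
  part below gamma + rho can be kept fixed while a covering of the rest is translated.  In the
  upward clause of <=_2 the set Y may lie below gamma; it is first replaced by a copy above
  gamma + rho whose pattern occurs cofinally.  Finally kappa_(alpha+beta) = gamma + kappa_beta.
*)

theory Submission
  imports Defs
begin

section \<open>Ordinal arithmetic\<close>

text \<open>The ordinal \<gamma> need not be divisible by \<rho>, so translation by \<gamma> need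
  not commute with \<open>f_xi\<close> near the bottom; divisibility of \<gamma> + x and of x is
  sure to agree only from x = \<rho> on. Hence the cut at \<gamma> + \<rho> rather than at \<gamma>
  + 1. The block in between does no harm: it contains no multiple of \<rho> above \<gamma>, and an
  ordinal that is \<open>less1\<close> another one is a multiple of \<rho>.

  Two translations \<gamma> and \<gamma>' with minimal successors are compared symmetrically, by
  induction on the larger argument, so that one transfer argument yields both directions; comparing
  x with \<gamma> + x is the case \<gamma>' = 0, as 1 is minimal. Since the downward clause of
  \<open>le2\<close> refers to \<open>le1\<close> at the larger argument itself, \<open>le1\<close>
  is settled first at each stage.

  A cofinal pattern is needed because coverings only preserve the relations: a copy of Y may satisfy
  more relations than Y, and then a covering of Y need not give a covering of the copy.\<close>

lemma ozero_le [simp]: "\<zero> \<le> (x :: 'a::ordinals)"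
  unfolding ozero_def by (rule Least_le) simp

lemma not_less_ozero [simp]: "\<not> x < (\<zero> :: 'a::ordinals)"
  by (simp add: not_less)

lemma ozero_less_iff: "\<zero> < (x :: 'a::ordinals) \<longleftrightarrow> x \<noteq> \<zero>"
  using ozero_le[of x] by (auto simp del: ozero_le simp: order_le_less)

text \<open>Replacement bounds the values \<open>\<alpha> \<oplus> \<delta>\<close>, so the
  \<open>LEAST\<close> in the recursion is taken over a nonempty set.\<close>

lemma oadd_spec: "\<alpha> \<le> \<alpha> \<oplus> \<beta> \<and> (\<forall>\<delta><\<beta>. \<alpha> \<oplus> \<delta> < \<alpha> \<oplus> (\<beta> :: 'a::ordinals))"
proof -
  obtain b where "\<forall>\<delta><\<beta>. \<alpha> \<oplus> \<delta> < b" using replacement by blast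
  then have "\<exists>\<gamma>. \<alpha> \<le> \<gamma> \<and> (\<forall>\<delta>\<in>{..<\<beta>}. \<alpha> \<oplus> \<delta> < \<gamma>)"
    by (intro exI[of _ "max \<alpha> b"]) (auto simp: less_max_iff_disj)
  from LeastI_ex[OF this] show ?thesis unfolding oadd.simps[of \<alpha> \<beta>, symmetric] by auto
qed

lemma oadd_ge_left: "\<alpha> \<le> \<alpha> \<oplus> (\<beta> :: 'a::ordinals)"
  using oadd_spec by blast

lemma oadd_strict_mono: "\<delta> < \<beta> \<Longrightarrow> \<alpha> \<oplus> \<delta> < \<alpha> \<oplus> (\<beta> :: 'a::ordinals)"
  using oadd_spec by blast

lemma oadd_least:
  "\<alpha> \<le> \<gamma> \<Longrightarrow> (\<And>\<delta>. \<delta> < \<beta> \<Longrightarrow> \<alpha> \<oplus> \<delta> < \<gamma>) \<Longrightarrow> \<alpha> \<oplus> \<beta> \<le> (\<gamma> :: 'a::ordinals)"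
  unfolding oadd.simps[of \<alpha> \<beta>] by (rule Least_le) auto

lemma oadd_less_iff [simp]: "\<alpha> \<oplus> \<delta> < \<alpha> \<oplus> \<beta> \<longleftrightarrow> \<delta> < (\<beta> :: 'a::ordinals)"
  by (metis oadd_strict_mono linorder_cases order_less_asym order_less_irrefl)

lemma oadd_le_iff [simp]: "\<alpha> \<oplus> \<delta> \<le> \<alpha> \<oplus> \<beta> \<longleftrightarrow> \<delta> \<le> (\<beta> :: 'a::ordinals)"
  by (meson linorder_not_less oadd_less_iff)

lemma oadd_eq_iff [simp]: "\<alpha> \<oplus> \<delta> = \<alpha> \<oplus> \<beta> \<longleftrightarrow> \<delta> = (\<beta> :: 'a::ordinals)"
  by (metis oadd_less_iff linorder_neq_iff)

lemma oadd_zero [simp]: "\<alpha> \<oplus> \<zero> = (\<alpha> :: 'a::ordinals)"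
  by (rule order_antisym[OF oadd_least oadd_ge_left]) auto

lemma oadd_ge_right: "\<beta> \<le> \<alpha> \<oplus> (\<beta> :: 'a::ordinals)"
  by (rule strict_mono_on_ge[of UNIV]) (auto intro: strict_mono_onI)

lemma zero_oadd [simp]: "\<zero> \<oplus> \<beta> = (\<beta> :: 'a::ordinals)"
proof (induction \<beta> rule: less_induct)
  case (less \<beta>)
  then show ?case by (intro order_antisym oadd_ge_right oadd_least) auto
qed

text \<open>Left subtraction: for the least \<delta> whose sum reaches \<beta>, all earlier sums
  stay below \<beta>, hence the sum cannot overshoot.\<close>

lemma ex_oadd_eq: "\<alpha> \<le> \<beta> \<Longrightarrow> \<exists>\<delta>. \<beta> = \<alpha> \<oplus> (\<delta> :: 'a::ordinals)"
proof -
  assume ab: "\<alpha> \<le> \<beta>"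
  define \<delta> where "\<delta> = (LEAST \<delta>. \<beta> \<le> \<alpha> \<oplus> \<delta>)"
  have "\<beta> \<le> \<alpha> \<oplus> \<delta>" unfolding \<delta>_def by (rule LeastI_ex) (use oadd_ge_right in blast)
  moreover have "\<alpha> \<oplus> \<delta> \<le> \<beta>"
    by (rule oadd_least[OF ab]) (use not_less_Least \<delta>_def linorder_not_le in blast)
  ultimately show ?thesis by (metis order_antisym)
qed

lemma le_oadd_cases:
  fixes \<alpha> :: "'a::ordinals"
  assumes "\<alpha> \<le> \<beta>" obtains \<delta> where "\<beta> = \<alpha> \<oplus> \<delta>"
  using ex_oadd_eq[OF assms] by blast

lemma oadd_assoc: "\<alpha> \<oplus> \<beta> \<oplus> \<gamma> = \<alpha> \<oplus> (\<beta> \<oplus> (\<gamma> :: 'a::ordinals))"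
proof (induction \<gamma> rule: less_induct)
  case (less \<gamma>)
  show ?case
  proof (rule order_antisym)
    show "\<alpha> \<oplus> \<beta> \<oplus> \<gamma> \<le> \<alpha> \<oplus> (\<beta> \<oplus> \<gamma>)"
      by (rule oadd_least) (simp_all add: less oadd_ge_left)
    have "\<alpha> \<oplus> \<epsilon> < \<alpha> \<oplus> \<beta> \<oplus> \<gamma>" if "\<epsilon> < \<beta> \<oplus> \<gamma>" for \<epsilon>
    proof (cases "\<beta> \<le> \<epsilon>")
      case True
      then obtain \<delta> where \<delta>: "\<epsilon> = \<beta> \<oplus> \<delta>" by (rule le_oadd_cases)
      then have "\<delta> < \<gamma>" using that by simp
      then show ?thesis using less[of \<delta>] oadd_strict_mono[of \<delta> \<gamma> "\<alpha> \<oplus> \<beta>"] \<delta> by simp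
    next
      case False
      then have "\<alpha> \<oplus> \<epsilon> < \<alpha> \<oplus> \<beta>" by simp
      then show ?thesis using oadd_ge_left by (rule order.strict_trans2)
    qed
    then show "\<alpha> \<oplus> (\<beta> \<oplus> \<gamma>) \<le> \<alpha> \<oplus> \<beta> \<oplus> \<gamma>"
      by (intro oadd_least) (meson oadd_ge_left order_trans)
  qed
qed

text \<open>The infinity axiom rules out a one-point type and thereby makes the \<open>LEAST\<close>
  that defines \<open>\<one>\<close> meaningful.\<close>

lemma oone_pos [simp]: "\<zero> < (\<one> :: 'a::ordinals)"
proof -
  obtain w :: 'a where "infinite {..<w}" using infinity by blast
  then have "{..<w} \<noteq> {}" by force
  then have "\<exists>x::'a. \<zero> < x" by (metis ex_in_conv lessThan_iff order.strict_trans1 ozero_le)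
  then show ?thesis unfolding oone_def by (rule LeastI_ex)
qed

lemma oone_le_iff [simp]: "\<one> \<le> (x :: 'a::ordinals) \<longleftrightarrow> \<zero> < x"
proof
  show "\<zero> < x" if "\<one> \<le> x" using oone_pos that by (rule order.strict_trans2)
  show "\<one> \<le> x" if "\<zero> < x" unfolding oone_def using that by (rule Least_le)
qed

lemma less_oone_iff [simp]: "x < (\<one> :: 'a::ordinals) \<longleftrightarrow> x = \<zero>"
  using oone_le_iff[of x] unfolding linorder_not_less[symmetric] by (auto simp: ozero_less_iff)

lemma succ_le_iff [simp]: "x \<oplus> \<one> \<le> y \<longleftrightarrow> x < (y :: 'a::ordinals)"
proof
  show "x < y" if "x \<oplus> \<one> \<le> y"
    by (rule order.strict_trans2[OF _ that]) (metis oadd_strict_mono oadd_zero oone_pos)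
  show "x \<oplus> \<one> \<le> y" if "x < y"
    by (rule oadd_least) (use that in auto)
qed

lemma less_succ_iff [simp]: "x < y \<oplus> \<one> \<longleftrightarrow> x \<le> (y :: 'a::ordinals)"
  using succ_le_iff[of y x] by (meson linorder_not_le)

lemma less_oadd_iff [simp]: "x < x \<oplus> y \<longleftrightarrow> \<zero> < (y :: 'a::ordinals)"
  using oadd_less_iff[of x \<zero> y] by simp

lemma omult_spec: "\<delta> < \<beta> \<Longrightarrow> \<alpha> \<otimes> \<delta> \<oplus> \<alpha> \<le> \<alpha> \<otimes> (\<beta> :: 'a::ordinals)"
proof -
  assume db: "\<delta> < \<beta>"
  obtain b where "\<forall>\<delta><\<beta>. \<alpha> \<otimes> \<delta> \<oplus> \<alpha> < b"
    using replacement[of \<beta> "\<lambda>\<delta>. \<alpha> \<otimes> \<delta> \<oplus> \<alpha>"] by blast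
  then have "\<exists>\<gamma>. \<forall>\<delta>\<in>{..<\<beta>}. \<alpha> \<otimes> \<delta> \<oplus> \<alpha> \<le> \<gamma>" by (auto intro: order_less_imp_le)
  from LeastI_ex[OF this] show ?thesis
    unfolding omult.simps[of \<alpha> \<beta>, symmetric] using db by blast
qed

lemma omult_least:
  "(\<And>\<delta>. \<delta> < \<beta> \<Longrightarrow> \<alpha> \<otimes> \<delta> \<oplus> \<alpha> \<le> \<gamma>) \<Longrightarrow> \<alpha> \<otimes> \<beta> \<le> (\<gamma> :: 'a::ordinals)"
  unfolding omult.simps[of \<alpha> \<beta>] by (rule Least_le) auto

section \<open>Finite sets and increasing maps\<close>

text \<open>X is an initial segment of both domain and range, and an increasing surjection between
  well-orders is the identity on a common initial segment. This recovers a map fixing X from a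
  covering that is given only as a set.\<close>

lemma initial_fixed:
  fixes h :: "'a::ordinals \<Rightarrow> 'a"
  assumes mono: "strict_mono_on (X \<union> Y) h" and "set_less X Y" "set_less X Y'"
    and eq: "X \<union> Y' = h ` (X \<union> Y)"
  shows "\<And>x. x \<in> X \<Longrightarrow> h x = x" "h ` Y = Y'"
proof -
  have hless: "h x < h y \<longleftrightarrow> x < y" if "x \<in> X \<union> Y" "y \<in> X \<union> Y" for x y
    using strict_mono_on_less[OF mono] that by blast
  show fixed: "h x = x" if "x \<in> X" for x
    using that
  proof (induction x rule: less_induct)
    case (less x)
    obtain w where w: "w \<in> X \<union> Y" "x = h w" using eq less.prems by blast
    \<comment> \<open>A preimage w of x below x would lie in X and be fixed by induction, giving w =
      x.\<close>
    have "\<not> w < x"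
    proof
      assume "w < x"
      then have "w \<in> X" using w(1) less.prems assms(2) unfolding set_less_def by force
      then show False using less.IH[of w] \<open>w < x\<close> w(2) by simp
    qed
    then have "h x \<le> x" using hless[of w x] w less.prems by (meson UnI1 linorder_not_le)
    moreover have "\<not> h x < x"
    proof
      assume hx: "h x < x"
      have "h x \<in> X \<union> Y'" using eq less.prems by blast
      then have "h x \<in> X" using hx less.prems assms(3) unfolding set_less_def by force
      then have "h (h x) = h x" using less.IH hx by blast
      then show False
        using hless[of "h x" x] hx \<open>h x \<in> X\<close> less.prems by simp
    qed
    ultimately show ?case by simp
  qed
  have X: "h ` X = X" using fixed by force
  have "h ` Y \<inter> X = {}"
  proof -
    have "h y \<notin> X" if "y \<in> Y" for y
      using that hless[of "h y" y] fixed[of "h y"] assms(2) unfolding set_less_def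
      by (metis UnCI order_less_irrefl)
    then show ?thesis by blast
  qed
  moreover have "Y' \<inter> X = {}" using assms(3) unfolding set_less_def by blast
  ultimately show "h ` Y = Y'" using eq X by (auto simp: image_Un)
qed

lemma sorted_list_of_set_image:
  assumes "finite Y" "strict_mono_on Y g"
  shows "sorted_list_of_set (g ` Y) = map g (sorted_list_of_set (Y :: 'a::linorder set))"
proof -
  have "sorted_wrt (<) (map g (sorted_list_of_set Y))"
    unfolding sorted_wrt_map
    by (rule sorted_wrt_mono_rel[OF _ strict_sorted_list_of_set])
      (use assms in \<open>auto simp: strict_mono_on_def\<close>)
  moreover have "set (map g (sorted_list_of_set Y)) = g ` Y" using assms by simp
  ultimately show ?thesis
    by (metis sorted_list_of_set.idem_if_sorted_distinct strict_sorted_iff)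
qed

text \<open>An increasing map sends the i-th element to the i-th element of the image; this removes
  the indices from the downward clause of \<open>le2\<close>.\<close>

lemma nth_condition:
  assumes "finite Y" "strict_mono_on Y g"
  shows "(\<forall>i<card Y. P (sorted_list_of_set Y ! i) \<longrightarrow> Q (sorted_list_of_set (g ` Y) ! i)) \<longleftrightarrow>
    (\<forall>y\<in>(Y :: 'a::linorder set). P y \<longrightarrow> Q (g y))"
proof -
  have "(\<forall>y\<in>Y. P y \<longrightarrow> Q (g y)) \<longleftrightarrow> (\<forall>y\<in>set (sorted_list_of_set Y). P y \<longrightarrow> Q (g y))"
    using assms by simp
  also have "\<dots> \<longleftrightarrow> (\<forall>i<card Y. P (sorted_list_of_set Y ! i) \<longrightarrow> Q (g (sorted_list_of_set Y ! i)))"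
    unfolding all_set_conv_all_nth by simp
  finally show ?thesis by (simp add: sorted_list_of_set_image[OF assms])
qed

text \<open>If every value p stopped occurring from some \<open>d p\<close> on, then beyond all the
  finitely many \<open>d p\<close> no value would be left. Limit and successor \<alpha> need no
  distinction.\<close>

lemma cofinal_pigeonhole:
  fixes P :: "'a::ordinals \<Rightarrow> 'b"
  assumes "finite (P ` {..<\<alpha>})" "\<zero> < \<alpha>"
  shows "\<exists>p. \<forall>\<delta><\<alpha>. \<exists>\<delta>'. \<delta> \<le> \<delta>' \<and> \<delta>' < \<alpha> \<and> P \<delta>' = p"
proof (rule ccontr)
  assume "\<not> ?thesis"
  then have "\<forall>p. \<exists>\<delta>. \<delta> < \<alpha> \<and> (\<forall>\<delta>'. \<delta> \<le> \<delta>' \<and> \<delta>' < \<alpha> \<longrightarrow> P \<delta>' \<noteq> p)" by blast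
  then obtain d where d: "\<And>p. d p < \<alpha>" "\<And>p \<delta>'. d p \<le> \<delta>' \<Longrightarrow> \<delta>' < \<alpha> \<Longrightarrow> P \<delta>' \<noteq> p" by metis
  \<comment> \<open>The maximum is attained, hence below \<alpha>, and the value taken at m itself
    already stopped at or before m.\<close>
  define m where "m = Max (d ` P ` {..<\<alpha>})"
  have "P \<zero> \<in> P ` {..<\<alpha>}" using assms(2) by blast
  then have fin: "finite (d ` P ` {..<\<alpha>})" "d ` P ` {..<\<alpha>} \<noteq> {}" using assms(1) by blast+
  have "m \<in> d ` P ` {..<\<alpha>}" unfolding m_def using fin by (rule Max_in)
  then have "m < \<alpha>" using d(1) by blast
  moreover from this have "d (P m) \<le> m" unfolding m_def using fin(1) by (intro Max_ge) auto
  ultimately show False using d(2) by blast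
qed

section \<open>Division by an additively indecomposable ordinal\<close>

locale indecomposable =
  fixes \<rho> :: "'a::ordinals"
  assumes indecomposable: "additively_indecomposable \<rho>"
begin

abbreviation dv :: "'a \<Rightarrow> bool"
  where "dv x \<equiv> divisible_by x \<rho>"

abbreviation cover :: "('a \<Rightarrow> 'a) \<Rightarrow> 'a set \<Rightarrow> bool"
  where "cover \<equiv> covering_map \<rho> (le1 \<rho>) (le2 \<rho>)"

lemma rho_pos [simp]: "\<zero> < \<rho>"
  using indecomposable unfolding additively_indecomposable_def by (simp add: ozero_less_iff)

lemma oadd_less_rho: "x < \<rho> \<Longrightarrow> y < \<rho> \<Longrightarrow> x \<oplus> y < \<rho>"
  using indecomposable unfolding additively_indecomposable_def by blast

lemma absorb: "\<epsilon> < \<rho> \<Longrightarrow> \<epsilon> \<oplus> \<rho> = \<rho>"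
  by (intro order_antisym oadd_ge_right oadd_least) (auto intro: oadd_less_rho)

text \<open>Division with remainder. Since x is at most its own multiple of \<rho>, a least \<zeta>
  exists; by its minimality the supremum defining \<open>\<rho> \<otimes> \<zeta>\<close> stays at
  or below x.\<close>

lemma ex_multiple: "\<exists>\<zeta>. \<rho> \<otimes> \<zeta> \<le> x \<and> x < \<rho> \<otimes> \<zeta> \<oplus> \<rho>"
proof -
  have "strict_mono_on UNIV (\<lambda>\<zeta>. \<rho> \<otimes> \<zeta>)"
    by (rule strict_mono_onI) (metis less_oadd_iff omult_spec order.strict_trans2 rho_pos)
  then have "x \<le> \<rho> \<otimes> x" by (rule strict_mono_on_ge) auto
  then have ex: "\<exists>\<zeta>. x < \<rho> \<otimes> \<zeta> \<oplus> \<rho>"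
    by (metis less_oadd_iff order.strict_trans1 rho_pos)
  define \<zeta> where "\<zeta> = (LEAST \<zeta>. x < \<rho> \<otimes> \<zeta> \<oplus> \<rho>)"
  have "x < \<rho> \<otimes> \<zeta> \<oplus> \<rho>" unfolding \<zeta>_def by (rule LeastI_ex[OF ex])
  moreover have "\<rho> \<otimes> \<zeta> \<le> x"
    by (rule omult_least) (use not_less_Least \<zeta>_def linorder_not_le in blast)
  ultimately show ?thesis by blast
qed

text \<open>This criterion avoids multiplication: it makes divisibility of \<open>\<gamma> \<oplus> x\<close> and of \<open>x\<close>
  comparable without the distributive law.\<close>

lemma dv_iff: "dv x \<longleftrightarrow> (\<forall>z<x. z \<oplus> \<rho> \<le> x)"
proof
  assume "dv x"
  then obtain \<delta> where \<delta>: "x = \<rho> \<otimes> \<delta>" unfolding divisible_by_def by blast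
  show "\<forall>z<x. z \<oplus> \<rho> \<le> x"
  proof (intro allI impI)
    fix z assume "z < x"
    \<comment> \<open>As x is the supremum of the ends of its blocks, z lies before the end of one
      of them.\<close>
    then obtain d where d: "d < \<delta>" "z < \<rho> \<otimes> d \<oplus> \<rho>"
      unfolding \<delta> using omult_least[of \<delta> \<rho> z] by (metis linorder_not_le)
    show "z \<oplus> \<rho> \<le> x"
    proof (cases "\<rho> \<otimes> d \<le> z")
      case True
      then obtain \<epsilon> where "z = \<rho> \<otimes> d \<oplus> \<epsilon>" by (rule le_oadd_cases)
      then have "z \<oplus> \<rho> = \<rho> \<otimes> d \<oplus> \<rho>" using d(2) by (simp add: oadd_assoc absorb)
      then show ?thesis using omult_spec[OF d(1)] \<delta> by simp
    next
      case False
      then obtain \<epsilon> where e: "\<rho> \<otimes> d = z \<oplus> \<epsilon>" by (metis le_oadd_cases linorder_linear)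
      have "z \<oplus> \<rho> \<le> z \<oplus> (\<epsilon> \<oplus> \<rho>)" by (simp add: oadd_ge_right)
      also have "\<dots> = \<rho> \<otimes> d \<oplus> \<rho>" by (simp add: e oadd_assoc)
      also have "\<dots> \<le> x" using omult_spec[OF d(1)] \<delta> by simp
      finally show ?thesis .
    qed
  qed
next
  assume *: "\<forall>z<x. z \<oplus> \<rho> \<le> x"
  obtain \<zeta> where "\<rho> \<otimes> \<zeta> \<le> x" "x < \<rho> \<otimes> \<zeta> \<oplus> \<rho>" using ex_multiple by blast
  then have "x = \<rho> \<otimes> \<zeta>" using * by (metis linorder_not_le order_le_less)
  then show "dv x" unfolding divisible_by_def by blast
qed

lemma dv_omult [simp]: "dv (\<rho> \<otimes> \<zeta>)"
  unfolding divisible_by_def by blast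

lemma dv_zero [simp]: "dv \<zero>"
  by (simp add: dv_iff)

lemma decompose:
  obtains \<sigma> \<epsilon> where "dv \<sigma>" "\<epsilon> < \<rho>" "x = \<sigma> \<oplus> \<epsilon>"
proof -
  obtain \<zeta> where "\<rho> \<otimes> \<zeta> \<le> x" "x < \<rho> \<otimes> \<zeta> \<oplus> \<rho>" using ex_multiple by blast
  then show ?thesis using that[of "\<rho> \<otimes> \<zeta>"] by (metis le_oadd_cases oadd_less_iff dv_omult)
qed

lemma decompose_unique:
  assumes "dv \<sigma>" "dv \<sigma>'" "\<epsilon> < \<rho>" "\<epsilon>' < \<rho>"
  shows "\<sigma> \<oplus> \<epsilon> = \<sigma>' \<oplus> \<epsilon>' \<longleftrightarrow> \<sigma> = \<sigma>' \<and> \<epsilon> = \<epsilon>'"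
proof -
  \<comment> \<open>Blocks starting at different multiples are disjoint: the earlier one ends at or
    before the start of the later one.\<close>
  have *: "\<tau> \<oplus> \<delta> < \<tau>' \<oplus> \<delta>'" if "dv \<tau>'" "\<delta> < \<rho>" "\<tau> < \<tau>'" for \<tau> \<tau>' \<delta> \<delta>'
  proof -
    have "\<tau> \<oplus> \<delta> < \<tau> \<oplus> \<rho>" using that by simp
    also have "\<dots> \<le> \<tau>'" using that dv_iff by blast
    also have "\<dots> \<le> \<tau>' \<oplus> \<delta>'" by (rule oadd_ge_left)
    finally show ?thesis .
  qed
  show ?thesis
    using *[of \<sigma>' \<epsilon> \<sigma> \<epsilon>'] *[of \<sigma> \<epsilon>' \<sigma>' \<epsilon>] assms by (cases \<sigma> \<sigma>' rule: linorder_cases) auto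
qed

lemma dv_oadd_iff: "dv \<sigma> \<Longrightarrow> \<epsilon> < \<rho> \<Longrightarrow> dv (\<sigma> \<oplus> \<epsilon>) \<longleftrightarrow> \<epsilon> = \<zero>"
  using decompose_unique[of "\<sigma> \<oplus> \<epsilon>" \<sigma> \<zero> \<epsilon>] by auto

lemma rho_le_dv: "dv x \<Longrightarrow> \<zero> < x \<Longrightarrow> \<rho> \<le> x"
  using dv_iff[of x] by (auto dest: spec[of _ \<zero>])

text \<open>By \<open>dv_iff\<close>, divisibility is a condition on the points z below. Those from
  \<gamma> on are translates of points below x; for z before \<gamma>, the summand x alone already
  provides the distance \<rho>. The bound on x is what permits an arbitrary \<gamma>.\<close>

lemma dv_shift:
  assumes "\<rho> \<le> x" shows "dv (\<gamma> \<oplus> x) \<longleftrightarrow> dv x"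
proof
  assume g: "dv (\<gamma> \<oplus> x)"
  show "dv x"
    unfolding dv_iff
  proof (intro allI impI)
    fix z assume "z < x"
    then have "\<gamma> \<oplus> z < \<gamma> \<oplus> x" by simp
    then have "\<gamma> \<oplus> z \<oplus> \<rho> \<le> \<gamma> \<oplus> x" using g unfolding dv_iff by blast
    then show "z \<oplus> \<rho> \<le> x" by (simp add: oadd_assoc)
  qed
next
  assume x: "dv x"
  show "dv (\<gamma> \<oplus> x)"
    unfolding dv_iff
  proof (intro allI impI)
    fix z assume z: "z < \<gamma> \<oplus> x"
    show "z \<oplus> \<rho> \<le> \<gamma> \<oplus> x"
    proof (cases "\<gamma> \<le> z")
      case True
      then obtain v where v: "z = \<gamma> \<oplus> v" by (rule le_oadd_cases)
      then have "v \<oplus> \<rho> \<le> x" using x z unfolding dv_iff by simp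
      then show ?thesis by (simp add: v oadd_assoc)
    next
      case False
      then have "z \<le> \<gamma>" by simp
      then obtain d where d: "\<gamma> = z \<oplus> d" by (rule le_oadd_cases)
      have "\<rho> \<le> d \<oplus> x" using assms oadd_ge_right by (rule order_trans)
      then show ?thesis by (simp add: d oadd_assoc)
    qed
  qed
qed

lemma f_xi_dv: "dv \<sigma> \<Longrightarrow> f_xi \<rho> \<xi> \<sigma> = \<sigma> \<oplus> \<xi>"
  by (simp add: f_xi_def)

lemma f_xi_not_dv:
  assumes "dv \<sigma>" "\<zero> < \<epsilon>" "\<epsilon> < \<rho>"
  shows "f_xi \<rho> \<xi> (\<sigma> \<oplus> \<epsilon>) = \<sigma>"
proof -
  have "\<not> dv (\<sigma> \<oplus> \<epsilon>)" using assms by (simp add: dv_oadd_iff)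
  moreover have "(THE y. \<exists>\<zeta> \<delta>. \<zero> < \<delta> \<and> \<delta> < \<rho> \<and> \<sigma> \<oplus> \<epsilon> = \<rho> \<otimes> \<zeta> \<oplus> \<delta> \<and> y = \<rho> \<otimes> \<zeta>) = \<sigma>"
  proof (rule the_equality)
    show "\<exists>\<zeta> \<delta>. \<zero> < \<delta> \<and> \<delta> < \<rho> \<and> \<sigma> \<oplus> \<epsilon> = \<rho> \<otimes> \<zeta> \<oplus> \<delta> \<and> \<sigma> = \<rho> \<otimes> \<zeta>"
      using assms unfolding divisible_by_def by blast
    fix y assume "\<exists>\<zeta> \<delta>. \<zero> < \<delta> \<and> \<delta> < \<rho> \<and> \<sigma> \<oplus> \<epsilon> = \<rho> \<otimes> \<zeta> \<oplus> \<delta> \<and> y = \<rho> \<otimes> \<zeta>"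
    then show "y = \<sigma>" using assms by (auto simp: decompose_unique)
  qed
  ultimately show ?thesis by (simp add: f_xi_def)
qed

lemma f_xi_fixed: "f_xi \<rho> \<xi> x = x \<Longrightarrow> dv x"
proof -
  assume fixed: "f_xi \<rho> \<xi> x = x"
  obtain \<sigma> \<epsilon> where "dv \<sigma>" "\<epsilon> < \<rho>" "x = \<sigma> \<oplus> \<epsilon>" by (rule decompose)
  then show "dv x" using fixed by (cases "\<epsilon> = \<zero>") (auto simp: f_xi_not_dv ozero_less_iff)
qed

lemma dv_rho [simp]: "dv \<rho>"
  by (simp add: dv_iff absorb)

lemma dv_le_oadd_iff:
  assumes "dv \<mu>" "\<epsilon> < \<rho>"
  shows "\<mu> \<le> \<sigma> \<oplus> \<epsilon> \<longleftrightarrow> \<mu> \<le> \<sigma>"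
proof
  assume *: "\<mu> \<le> \<sigma> \<oplus> \<epsilon>"
  show "\<mu> \<le> \<sigma>"
  proof (rule ccontr)
    assume "\<not> \<mu> \<le> \<sigma>"
    then have "\<sigma> \<oplus> \<rho> \<le> \<mu>" using assms dv_iff by simp
    then have "\<sigma> \<oplus> \<rho> \<le> \<sigma> \<oplus> \<epsilon>" using * by (rule order_trans)
    then show False using assms(2) by simp
  qed
next
  show "\<mu> \<le> \<sigma> \<oplus> \<epsilon>" if "\<mu> \<le> \<sigma>" using that oadd_ge_left by (rule order_trans)
qed

text \<open>\<open>f_xi\<close> never leaves the block of length \<rho> containing its argument, so
  it cannot cross a multiple of \<rho>.\<close>

lemma dv_le_f_xi_iff:
  assumes "dv \<mu>" "\<xi> < \<rho>"
  shows "\<mu> \<le> f_xi \<rho> \<xi> x \<longleftrightarrow> \<mu> \<le> x"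
proof -
  obtain \<sigma> \<epsilon> where "dv \<sigma>" "\<epsilon> < \<rho>" "x = \<sigma> \<oplus> \<epsilon>" by (rule decompose)
  then show ?thesis
    using assms by (cases "\<epsilon> = \<zero>") (auto simp: f_xi_dv f_xi_not_dv dv_le_oadd_iff ozero_less_iff)
qed

lemma f_xi_shift:
  assumes "\<rho> \<le> x"
  shows "f_xi \<rho> \<xi> (\<gamma> \<oplus> x) = \<gamma> \<oplus> f_xi \<rho> \<xi> x"
proof -
  obtain \<sigma> \<epsilon> where x: "dv \<sigma>" "\<epsilon> < \<rho>" "x = \<sigma> \<oplus> \<epsilon>" by (rule decompose)
  then have "dv (\<gamma> \<oplus> \<sigma>)" using assms by (simp add: dv_le_oadd_iff dv_shift)
  then show ?thesis
    using x by (cases "\<epsilon> = \<zero>")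
      (auto simp: f_xi_dv f_xi_not_dv oadd_assoc[symmetric] ozero_less_iff)
qed


section \<open>Closed sets and coverings\<close>

lemma rho_closed_insert: "dv \<mu> \<Longrightarrow> rho_closed \<rho> Z \<Longrightarrow> rho_closed \<rho> (insert \<mu> Z)"
  unfolding rho_closed_def by (metis decompose_unique insert_iff oadd_zero rho_pos)

lemma rho_closed_dv: "(\<And>z. z \<in> Z \<Longrightarrow> dv z) \<Longrightarrow> rho_closed \<rho> Z"
  unfolding rho_closed_def by (metis dv_oadd_iff oadd_zero)

lemma rho_closedD: "rho_closed \<rho> Z \<Longrightarrow> dv \<sigma> \<Longrightarrow> \<xi> < \<rho> \<Longrightarrow> \<sigma> \<oplus> \<xi> \<in> Z \<Longrightarrow> \<sigma> \<in> Z"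
  unfolding rho_closed_def by blast

lemma cover_subset: "cover h Z \<Longrightarrow> X \<subseteq> Z \<Longrightarrow> cover h X"
  unfolding covering_map_def by (meson monotone_on_subset subset_eq)

lemma cover_mono: "cover h Z \<Longrightarrow> x \<in> Z \<Longrightarrow> y \<in> Z \<Longrightarrow> h x < h y \<longleftrightarrow> x < y"
  unfolding covering_map_def by (meson strict_mono_on_less)

text \<open>Divisibility does not occur in the definition of a covering, but the multiples of \<rho>
  are exactly the fixed points of \<open>f_xi\<close> with index zero.\<close>

lemma cover_dv:
  assumes "cover h Z" "\<sigma> \<in> Z" "dv \<sigma>"
  shows "dv (h \<sigma>)"
proof -
  have "f_xi \<rho> \<zero> \<sigma> = \<sigma>" using assms by (simp add: f_xi_dv)
  then have "f_xi \<rho> \<zero> (h \<sigma>) = h \<sigma>"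
    using assms rho_pos unfolding covering_map_def by blast
  then show ?thesis by (rule f_xi_fixed)
qed

lemma cover_oadd:
  assumes "cover h Z" "\<sigma> \<in> Z" "dv \<sigma>" "\<sigma> \<oplus> \<xi> \<in> Z" "\<xi> < \<rho>"
  shows "h (\<sigma> \<oplus> \<xi>) = h \<sigma> \<oplus> \<xi>"
proof -
  have "f_xi \<rho> \<xi> \<sigma> = \<sigma> \<oplus> \<xi>" using assms by (simp add: f_xi_dv)
  then have "f_xi \<rho> \<xi> (h \<sigma>) = h (\<sigma> \<oplus> \<xi>)"
    using assms unfolding covering_map_def by blast
  then show ?thesis using cover_dv assms by (simp add: f_xi_dv)
qed

text \<open>A covering acts on the multiples of \<rho> and copies remainders, so the start of a
  block in the image comes from the start of a block in Z. This is what lets coverings be applied in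
  succession.\<close>

lemma rho_closed_image:
  assumes "cover h Z" "rho_closed \<rho> Z"
  shows "rho_closed \<rho> (h ` Z)"
  unfolding rho_closed_def
proof (intro allI impI, elim conjE exE)
  fix \<sigma> \<xi> assume \<sigma>: "dv \<sigma>" and \<xi>: "\<xi> < \<rho>" and "\<sigma> \<oplus> \<xi> \<in> h ` Z"
  then obtain z where z: "z \<in> Z" "\<sigma> \<oplus> \<xi> = h z" by blast
  obtain \<tau> \<epsilon> where t: "dv \<tau>" "\<epsilon> < \<rho>" "z = \<tau> \<oplus> \<epsilon>" by (rule decompose)
  then have "\<tau> \<in> Z" using assms(2) z(1) rho_closedD by blast
  moreover from this have "\<sigma> \<oplus> \<xi> = h \<tau> \<oplus> \<epsilon>" "dv (h \<tau>)"
    using cover_oadd[OF assms(1)] cover_dv[OF assms(1)] z t by auto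
  ultimately show "\<sigma> \<in> h ` Z" using decompose_unique \<sigma> \<xi> t(2) by blast
qed

lemma cover_comp: "cover h Z \<Longrightarrow> cover g (h ` Z) \<Longrightarrow> cover (\<lambda>z. g (h z)) Z"
  unfolding covering_map_def by (auto simp: strict_mono_on_def)

lemma cover_id: "cover (\<lambda>z. z) Z"
  unfolding covering_map_def by (auto simp: strict_mono_on_def)

text \<open>Exchanges coverings as sets for maps that are the identity on X. The predicate Q is a
  slot for the extra condition of the downward clause.\<close>

lemma is_covering_below_iff:
  assumes "rho_closed \<rho> (X \<union> Y)" "set_less X Y"
  shows "(\<exists>Y'. finite Y' \<and> Y' \<subseteq> S \<and> set_less X Y' \<and>
            is_covering \<rho> (le1 \<rho>) (le2 \<rho>) (X \<union> Y') (X \<union> Y) \<and> Q Y') \<longleftrightarrow>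
         (\<exists>g. cover g (X \<union> Y) \<and> (\<forall>x\<in>X. g x = x) \<and> finite (g ` Y) \<and> g ` Y \<subseteq> S \<and> Q (g ` Y))"
    (is "?L \<longleftrightarrow> ?R")
proof
  assume ?L
  then obtain Y' h where *: "finite Y'" "Y' \<subseteq> S" "set_less X Y'" "cover h (X \<union> Y)"
    "X \<union> Y' = h ` (X \<union> Y)" "Q Y'" unfolding is_covering_def by blast
  then have "strict_mono_on (X \<union> Y) h" unfolding covering_map_def by blast
  then have "\<And>x. x \<in> X \<Longrightarrow> h x = x" "h ` Y = Y'" using initial_fixed assms(2) * by blast+
  then show ?R using * by blast
next
  assume ?R
  then obtain g where g: "cover g (X \<union> Y)" "\<forall>x\<in>X. g x = x" "finite (g ` Y)" "g ` Y \<subseteq> S" "Q (g ` Y)"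
    by blast
  then have "X \<union> g ` Y = g ` (X \<union> Y)" by force
  moreover have "set_less X (g ` Y)"
    using assms(2) cover_mono[OF g(1)] g(2) unfolding set_less_def by fastforce
  ultimately show ?L using g assms(1) unfolding is_covering_def by blast
qed

text \<open>One set replaces the pair X, Y of the clauses: \<alpha> determines the split, and the
  part of Z below \<alpha> plays the role of X.\<close>

definition reflects :: "'a \<Rightarrow> 'a set \<Rightarrow> ('a \<Rightarrow> 'a) \<Rightarrow> bool"
  where "reflects \<alpha> Z g \<longleftrightarrow> cover g Z \<and> g ` Z \<subseteq> {..<\<alpha>} \<and> (\<forall>z\<in>Z. z < \<alpha> \<longrightarrow> g z = z)"

definition cofinally :: "'a set \<Rightarrow> 'a set \<Rightarrow> 'a \<Rightarrow> bool"
  where "cofinally X Y \<alpha> \<longleftrightarrow>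
    (\<forall>\<delta><\<alpha>. \<exists>g. cover g (X \<union> Y) \<and> (\<forall>x\<in>X. g x = x) \<and> g ` Y \<subseteq> {\<delta><..<\<alpha>})"

text \<open>Used twice: with Q trivial for \<open>le1\<close>, and with Q the condition on indices
  for the downward clause of \<open>le2\<close>.\<close>

lemma split_reflects:
  assumes "\<alpha> \<le> \<beta>"
  shows "(\<forall>X Y. finite X \<and> X \<subseteq> {..<\<alpha>} \<and> finite Y \<and> Y \<subseteq> {\<alpha>..<\<beta>} \<and> rho_closed \<rho> (X \<union> Y) \<longrightarrow>
      (\<exists>Y'. finite Y' \<and> Y' \<subseteq> {..<\<alpha>} \<and> set_less X Y' \<and>
            is_covering \<rho> (le1 \<rho>) (le2 \<rho>) (X \<union> Y') (X \<union> Y) \<and> Q Y Y')) \<longleftrightarrow>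
    (\<forall>Z. finite Z \<and> Z \<subseteq> {..<\<beta>} \<and> rho_closed \<rho> Z \<longrightarrow>
      (\<exists>g. reflects \<alpha> Z g \<and> Q (Z \<inter> {\<alpha>..}) (g ` (Z \<inter> {\<alpha>..}))))" (is "?L \<longleftrightarrow> ?R")
proof
  assume L: ?L
  show ?R
  proof (intro allI impI, elim conjE)
    fix Z assume Z: "finite Z" "Z \<subseteq> {..<\<beta>}" "rho_closed \<rho> Z"
    define X Y where "X = Z \<inter> {..<\<alpha>}" and "Y = Z \<inter> {\<alpha>..}"
    have XY: "X \<union> Y = Z" unfolding X_def Y_def by auto
    have less: "set_less X Y" unfolding set_less_def X_def Y_def by auto
    have "finite X \<and> X \<subseteq> {..<\<alpha>} \<and> finite Y \<and> Y \<subseteq> {\<alpha>..<\<beta>} \<and> rho_closed \<rho> (X \<union> Y)"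
      using Z unfolding XY by (auto simp: X_def Y_def)
    then have "\<exists>Y'. finite Y' \<and> Y' \<subseteq> {..<\<alpha>} \<and> set_less X Y' \<and>
            is_covering \<rho> (le1 \<rho>) (le2 \<rho>) (X \<union> Y') (X \<union> Y) \<and> Q Y Y'" using L by blast
    then obtain g where g: "cover g Z" "\<forall>x\<in>X. g x = x" "g ` Y \<subseteq> {..<\<alpha>}" "Q Y (g ` Y)"
      using is_covering_below_iff[of X Y] less Z(3) unfolding XY by auto
    have "g z < \<alpha>" if "z \<in> Z" for z
    proof (cases "z < \<alpha>")
      case True
      then show ?thesis using g(2) that X_def by simp
    next
      case False
      then have "z \<in> Y" using that by (simp add: Y_def)
      then show ?thesis using g(3) by blast
    qed
    then have "reflects \<alpha> Z g" using g unfolding reflects_def X_def by auto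
    then show "\<exists>g. reflects \<alpha> Z g \<and> Q (Z \<inter> {\<alpha>..}) (g ` (Z \<inter> {\<alpha>..}))"
      using g(4) unfolding Y_def by blast
  qed
next
  assume R: ?R
  show ?L
  proof (intro allI impI, elim conjE)
    fix X Y assume XY: "finite X" "X \<subseteq> {..<\<alpha>}" "finite Y" "Y \<subseteq> {\<alpha>..<\<beta>}" "rho_closed \<rho> (X \<union> Y)"
    have "finite (X \<union> Y) \<and> X \<union> Y \<subseteq> {..<\<beta>} \<and> rho_closed \<rho> (X \<union> Y)" using XY assms by auto
    then obtain g where g: "reflects \<alpha> (X \<union> Y) g"
      "Q ((X \<union> Y) \<inter> {\<alpha>..}) (g ` ((X \<union> Y) \<inter> {\<alpha>..}))" using R by blast
    have Y: "(X \<union> Y) \<inter> {\<alpha>..} = Y" using XY by auto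
    have less: "set_less X Y" using XY unfolding set_less_def by force
    show "\<exists>Y'. finite Y' \<and> Y' \<subseteq> {..<\<alpha>} \<and> set_less X Y' \<and>
            is_covering \<rho> (le1 \<rho>) (le2 \<rho>) (X \<union> Y') (X \<union> Y) \<and> Q Y Y'"
      unfolding is_covering_below_iff[OF XY(5) less]
      using g XY unfolding Y reflects_def by (intro exI[of _ g]) auto
  qed
qed

lemma le1_reflects:
  "le1 \<rho> \<alpha> \<beta> \<longleftrightarrow> \<alpha> \<le> \<beta> \<and>
    (\<forall>Z. finite Z \<and> Z \<subseteq> {..<\<beta>} \<and> rho_closed \<rho> Z \<longrightarrow> (\<exists>g. reflects \<alpha> Z g))"
proof (cases "\<alpha> \<le> \<beta>")
  case True
  show ?thesis
    unfolding le1_iff[of \<rho> \<alpha> \<beta>] le1_clause_def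
    using split_reflects[OF True, of "\<lambda>_ _. True"] True by (simp only: simp_thms)
qed (simp add: le1_iff[of \<rho> \<alpha> \<beta>] le1_clause_def)

lemma cofinal_coverings_iff:
  assumes "finite X" "X \<subseteq> {..<\<alpha>}" "finite Y" "rho_closed \<rho> (X \<union> Y)" "set_less X Y"
  shows "cofinal_coverings \<rho> (le1 \<rho>) (le2 \<rho>) X Y \<alpha> \<longleftrightarrow> cofinally X Y \<alpha>"
proof
  assume L: "cofinal_coverings \<rho> (le1 \<rho>) (le2 \<rho>) X Y \<alpha>"
  show "cofinally X Y \<alpha>"
    unfolding cofinally_def
  proof (intro allI impI)
    fix \<delta> assume \<delta>: "\<delta> < \<alpha>"
    \<comment> \<open>\<open>cofinal_coverings\<close> does not ask for X to lie below the new set;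
      raising the bound above X enforces this.\<close>
    define m where "m = Max (insert \<delta> X)"
    have m: "m < \<alpha>" "\<delta> \<le> m" "\<And>x. x \<in> X \<Longrightarrow> x \<le> m"
      unfolding m_def using assms \<delta> by auto
    obtain Y' where Y': "finite Y'" "Y' \<subseteq> {m<..<\<alpha>}" "is_covering \<rho> (le1 \<rho>) (le2 \<rho>) (X \<union> Y') (X \<union> Y)"
      using L m(1) unfolding cofinal_coverings_def by blast
    then have "set_less X Y'" using m(3) unfolding set_less_def by force
    then obtain g where "cover g (X \<union> Y)" "\<forall>x\<in>X. g x = x" "g ` Y \<subseteq> {m<..<\<alpha>}"
      using is_covering_below_iff[OF assms(4,5), of "{m<..<\<alpha>}" "\<lambda>_. True"] Y' by auto
    moreover have "{m<..<\<alpha>} \<subseteq> {\<delta><..<\<alpha>}" using m(2) by auto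
    ultimately show "\<exists>g. cover g (X \<union> Y) \<and> (\<forall>x\<in>X. g x = x) \<and> g ` Y \<subseteq> {\<delta><..<\<alpha>}" by blast
  qed
next
  assume R: "cofinally X Y \<alpha>"
  show "cofinal_coverings \<rho> (le1 \<rho>) (le2 \<rho>) X Y \<alpha>"
    unfolding cofinal_coverings_def
  proof (intro allI impI)
    fix \<delta> assume "\<delta> < \<alpha>"
    then obtain g where g: "cover g (X \<union> Y)" "\<forall>x\<in>X. g x = x" "g ` Y \<subseteq> {\<delta><..<\<alpha>}"
      using R unfolding cofinally_def by blast
    then show "\<exists>Y'. finite Y' \<and> Y' \<subseteq> {\<delta><..<\<alpha>} \<and>
        is_covering \<rho> (le1 \<rho>) (le2 \<rho>) (X \<union> Y') (X \<union> Y)"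
      using is_covering_below_iff[OF assms(4,5), of "{\<delta><..<\<alpha>}" "\<lambda>_. True"] assms(3) by auto
  qed
qed

lemma le2_reflects:
  "le2 \<rho> \<alpha> \<beta> \<longleftrightarrow> \<alpha> \<le> \<beta> \<and>
    (\<forall>X Y. finite X \<and> X \<subseteq> {..<\<alpha>} \<and> finite Y \<and> Y \<subseteq> {..<\<alpha>} \<and> rho_closed \<rho> (X \<union> Y) \<and> set_less X Y \<longrightarrow>
      cofinally X Y \<alpha> \<longrightarrow> cofinally X Y \<beta>) \<and>
    (\<forall>Z. finite Z \<and> Z \<subseteq> {..<\<beta>} \<and> rho_closed \<rho> Z \<longrightarrow>
      (\<exists>g. reflects \<alpha> Z g \<and> (\<forall>z\<in>Z. \<alpha> \<le> z \<longrightarrow> le1 \<rho> z \<beta> \<longrightarrow> le1 \<rho> (g z) \<alpha>)))"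
proof (cases "\<alpha> \<le> \<beta>")
  case True
  have "le2_up_clause \<rho> (le1 \<rho>) (le2 \<rho>) \<alpha> \<beta> \<longleftrightarrow>
    (\<forall>X Y. finite X \<and> X \<subseteq> {..<\<alpha>} \<and> finite Y \<and> Y \<subseteq> {..<\<alpha>} \<and> rho_closed \<rho> (X \<union> Y) \<and> set_less X Y \<longrightarrow>
      cofinally X Y \<alpha> \<longrightarrow> cofinally X Y \<beta>)"
  proof -
    have cc: "cofinal_coverings \<rho> (le1 \<rho>) (le2 \<rho>) X Y \<alpha> \<longleftrightarrow> cofinally X Y \<alpha>"
      "cofinal_coverings \<rho> (le1 \<rho>) (le2 \<rho>) X Y \<beta> \<longleftrightarrow> cofinally X Y \<beta>"
      if "finite X \<and> X \<subseteq> {..<\<alpha>} \<and> finite Y \<and> Y \<subseteq> {..<\<alpha>} \<and> rho_closed \<rho> (X \<union> Y) \<and> set_less X Y" for X Y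
    proof -
      have "X \<subseteq> {..<\<beta>}" using that True by force
      then show "cofinal_coverings \<rho> (le1 \<rho>) (le2 \<rho>) X Y \<alpha> \<longleftrightarrow> cofinally X Y \<alpha>"
        "cofinal_coverings \<rho> (le1 \<rho>) (le2 \<rho>) X Y \<beta> \<longleftrightarrow> cofinally X Y \<beta>"
        using that by (simp_all add: cofinal_coverings_iff)
    qed
    show ?thesis
      unfolding le2_up_clause_def by (intro all_cong1 imp_cong refl) (simp_all add: cc)
  qed
  moreover have "(\<forall>i<card (Z \<inter> {\<alpha>..}). le1 \<rho> (sorted_list_of_set (Z \<inter> {\<alpha>..}) ! i) \<beta> \<longrightarrow>
      le1 \<rho> (sorted_list_of_set (g ` (Z \<inter> {\<alpha>..})) ! i) \<alpha>) \<longleftrightarrow>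
    (\<forall>z\<in>Z. \<alpha> \<le> z \<longrightarrow> le1 \<rho> z \<beta> \<longrightarrow> le1 \<rho> (g z) \<alpha>)" if "finite Z" "reflects \<alpha> Z g" for Z g
  proof -
    have "strict_mono_on (Z \<inter> {\<alpha>..}) g"
      using that unfolding reflects_def covering_map_def by (meson inf_le1 monotone_on_subset)
    then show ?thesis
      using nth_condition[of "Z \<inter> {\<alpha>..}" g "\<lambda>z. le1 \<rho> z \<beta>" "\<lambda>z. le1 \<rho> z \<alpha>"] that(1) by auto
  qed
  then have "le2_down_clause \<rho> (le1 \<rho>) (le2 \<rho>) \<alpha> \<beta> \<longleftrightarrow>
    (\<forall>Z. finite Z \<and> Z \<subseteq> {..<\<beta>} \<and> rho_closed \<rho> Z \<longrightarrow>
      (\<exists>g. reflects \<alpha> Z g \<and> (\<forall>z\<in>Z. \<alpha> \<le> z \<longrightarrow> le1 \<rho> z \<beta> \<longrightarrow> le1 \<rho> (g z) \<alpha>)))"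
    unfolding le2_down_clause_def split_reflects[OF True, where Q = "\<lambda>Y Y'. \<forall>i<card Y.
      le1 \<rho> (sorted_list_of_set Y ! i) \<beta> \<longrightarrow> le1 \<rho> (sorted_list_of_set Y' ! i) \<alpha>"]
    by (intro all_cong1 imp_cong ex_cong1 conj_cong refl) blast
  ultimately show ?thesis unfolding le2_iff[of \<rho> \<alpha> \<beta>] le2_clause_def using True by (simp only: simp_thms)
qed (simp add: le2_iff[of \<rho> \<alpha> \<beta>] le2_clause_def)

section \<open>The relation \<open>\<le>\<^sub>1\<close> and its minimal elements\<close>

lemma le1_imp_le: "le1 \<rho> \<alpha> \<beta> \<Longrightarrow> \<alpha> \<le> \<beta>"
  unfolding le1_reflects[of \<alpha> \<beta>] by blast

lemma reflects_id: "Z \<subseteq> {..<\<alpha>} \<Longrightarrow> reflects \<alpha> Z (\<lambda>z. z)"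
  unfolding reflects_def using cover_id by simp

lemma le1_refl [simp]: "le1 \<rho> \<alpha> \<alpha>"
  unfolding le1_reflects[of \<alpha> \<alpha>] using reflects_id[of _ \<alpha>] by blast

lemma le2_refl [simp]: "le2 \<rho> \<alpha> \<alpha>"
proof -
  have "\<exists>g. reflects \<alpha> Z g \<and> (\<forall>z\<in>Z. \<alpha> \<le> z \<longrightarrow> le1 \<rho> z \<alpha> \<longrightarrow> le1 \<rho> (g z) \<alpha>)"
    if "Z \<subseteq> {..<\<alpha>}" for Z
    using reflects_id[OF that] by (intro exI[of _ "\<lambda>z. z"]) simp
  then show ?thesis unfolding le2_reflects[of \<alpha> \<alpha>] by simp
qed

lemma le2_imp_le1: "le2 \<rho> \<alpha> \<beta> \<Longrightarrow> le1 \<rho> \<alpha> \<beta>"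
proof -
  assume "le2 \<rho> \<alpha> \<beta>"
  then have "\<alpha> \<le> \<beta>" and "\<exists>g. reflects \<alpha> Z g \<and> (\<forall>z\<in>Z. \<alpha> \<le> z \<longrightarrow> le1 \<rho> z \<beta> \<longrightarrow> le1 \<rho> (g z) \<alpha>)"
    if "finite Z" "Z \<subseteq> {..<\<beta>}" "rho_closed \<rho> Z" for Z
    unfolding le2_reflects[of \<alpha> \<beta>] using that by simp_all
  \<comment> \<open>The facts just obtained are conditional on Z; the empty set, which is closed,
    yields the inequality.\<close>
  then show "le1 \<rho> \<alpha> \<beta>"
    unfolding le1_reflects[of \<alpha> \<beta>] by (metis empty_subsetI finite.emptyI rho_closed_dv ex_in_conv)
qed

lemma le1_initial:
  assumes "le1 \<rho> \<alpha> \<gamma>" "\<alpha> \<le> \<beta>" "\<beta> \<le> \<gamma>"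
  shows "le1 \<rho> \<alpha> \<beta>"
proof -
  have "{..<\<beta>} \<subseteq> {..<\<gamma>}" using assms(3) by auto
  then show ?thesis using assms(1,2) unfolding le1_reflects[of \<alpha>] by (meson subset_trans)
qed

text \<open>Reflections compose, because the image of a closed set under the first is again a finite
  closed set, now below \<beta>.\<close>

lemma le1_trans:
  assumes ab: "le1 \<rho> \<alpha> \<beta>" and bc: "le1 \<rho> \<beta> \<gamma>"
  shows "le1 \<rho> \<alpha> \<gamma>"
proof -
  have le: "\<alpha> \<le> \<beta>" "\<beta> \<le> \<gamma>" using assms le1_imp_le by blast+
  have "\<exists>g. reflects \<alpha> Z g" if Z: "finite Z" "Z \<subseteq> {..<\<gamma>}" "rho_closed \<rho> Z" for Z
  proof -
    obtain g where g: "reflects \<beta> Z g" using bc Z unfolding le1_reflects[of \<beta> \<gamma>] by blast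
    then have "rho_closed \<rho> (g ` Z)" using Z(3) rho_closed_image unfolding reflects_def by blast
    moreover have "finite (g ` Z)" "g ` Z \<subseteq> {..<\<beta>}" using Z(1) g unfolding reflects_def by auto
    ultimately obtain h where h: "reflects \<alpha> (g ` Z) h"
      using ab unfolding le1_reflects[of \<alpha> \<beta>] by blast
    have "h (g z) = z" if "z \<in> Z" "z < \<alpha>" for z
    proof -
      have "g z = z" using g that le(1) unfolding reflects_def by (meson order.strict_trans2)
      then show ?thesis using h that unfolding reflects_def by (metis imageI)
    qed
    moreover have "cover (\<lambda>z. h (g z)) Z"
      using cover_comp[of g Z h] g h unfolding reflects_def by simp
    moreover have "(\<lambda>z. h (g z)) ` Z \<subseteq> {..<\<alpha>}" using h unfolding reflects_def by (simp add: image_image)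
    ultimately have "reflects \<alpha> Z (\<lambda>z. h (g z))" unfolding reflects_def by simp
    then show ?thesis by blast
  qed
  then show ?thesis using le unfolding le1_reflects[of \<alpha> \<gamma>] by (meson order_trans)
qed

text \<open>Reflect \<alpha> together with the multiple \<sigma> at the start of its block. If
  \<sigma> were below \<alpha>, it would be fixed, and then so would \<alpha>, which has to move
  below itself.\<close>

lemma le1_less_dv:
  assumes "le1 \<rho> \<alpha> \<beta>" "\<alpha> < \<beta>"
  shows "dv \<alpha>"
proof -
  obtain \<sigma> \<epsilon> where a: "dv \<sigma>" "\<epsilon> < \<rho>" "\<alpha> = \<sigma> \<oplus> \<epsilon>" by (rule decompose)
  show ?thesis
  proof (cases "\<epsilon> = \<zero>")
    case False
    have "\<sigma> < \<alpha>" using False a(3) by (simp add: ozero_less_iff)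
    have "rho_closed \<rho> {\<sigma>, \<alpha>}"
      unfolding rho_closed_def using decompose_unique[OF _ a(1)] a
      by (metis insert_iff oadd_zero rho_pos singletonD)
    moreover have "{\<sigma>, \<alpha>} \<subseteq> {..<\<beta>}" using assms \<open>\<sigma> < \<alpha>\<close> by auto
    ultimately obtain g where g: "reflects \<alpha> {\<sigma>, \<alpha>} g"
      using assms(1) unfolding le1_reflects[of \<alpha> \<beta>] by (metis finite.emptyI finite.insertI)
    then have "g \<alpha> = g \<sigma> \<oplus> \<epsilon>" "g \<sigma> = \<sigma>"
      using cover_oadd[of g _ \<sigma> \<epsilon>] a \<open>\<sigma> < \<alpha>\<close> unfolding reflects_def by auto
    then show ?thesis using g a(3) unfolding reflects_def by simp
  qed (use a in simp)
qed

text \<open>Reflecting \<alpha> over the fixed multiple \<sigma> below z produces another multiple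
  strictly between \<sigma> and \<alpha>. Thus \<alpha> is a limit of multiples of \<rho>.\<close>

lemma le1_less_limit:
  assumes "le1 \<rho> \<alpha> \<beta>" "\<alpha> < \<beta>" "z < \<alpha>"
  shows "z \<oplus> \<rho> < \<alpha>"
proof -
  obtain \<sigma> \<epsilon> where z: "dv \<sigma>" "\<epsilon> < \<rho>" "z = \<sigma> \<oplus> \<epsilon>" by (rule decompose)
  have a: "dv \<alpha>" using assms le1_less_dv by blast
  have "\<sigma> < \<alpha>" using oadd_ge_left assms(3) unfolding z(3) by (rule order.strict_trans1)
  have "rho_closed \<rho> {\<sigma>, \<alpha>}" using z(1) a by (auto intro: rho_closed_dv)
  moreover have "{\<sigma>, \<alpha>} \<subseteq> {..<\<beta>}" using assms \<open>\<sigma> < \<alpha>\<close> by auto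
  ultimately obtain g where g: "reflects \<alpha> {\<sigma>, \<alpha>} g"
    using assms(1) unfolding le1_reflects[of \<alpha> \<beta>] by (metis finite.emptyI finite.insertI)
  then have "dv (g \<alpha>)" "g \<sigma> < g \<alpha>" "g \<sigma> = \<sigma>" "g \<alpha> < \<alpha>"
    using cover_dv[of g _ \<alpha>] cover_mono[of g _ \<sigma> \<alpha>] a \<open>\<sigma> < \<alpha>\<close> unfolding reflects_def by auto
  then have "\<sigma> \<oplus> \<rho> < \<alpha>" using dv_iff by (metis order.strict_trans1)
  then show ?thesis using z by (simp add: oadd_assoc absorb)
qed

lemma zero_minimal: "\<zero> \<in> le1_minimal \<rho>"
  unfolding le1_minimal_def less1_def using le1_imp_le[of _ \<zero>] by (simp add: order_le_less)

lemma not_zero_le1: "\<zero> < \<beta> \<Longrightarrow> \<not> le1 \<rho> \<zero> \<beta>"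
proof
  assume "\<zero> < \<beta>" "le1 \<rho> \<zero> \<beta>"
  moreover have "finite {\<zero>}" "rho_closed \<rho> {\<zero>}" by (auto intro: rho_closed_dv)
  moreover have "{\<zero>} \<subseteq> {..<\<beta>}" using \<open>\<zero> < \<beta>\<close> by simp
  ultimately obtain g where "reflects \<zero> {\<zero>} g" unfolding le1_reflects[of \<zero> \<beta>] by blast
  then show False unfolding reflects_def by simp
qed

lemma minimalD: "\<mu> \<in> le1_minimal \<rho> \<Longrightarrow> le1 \<rho> \<xi> \<mu> \<Longrightarrow> \<xi> = \<mu>"
  unfolding le1_minimal_def less1_def by blast

lemma minimalI: "(\<And>\<xi>. \<xi> < \<mu> \<Longrightarrow> \<not> le1 \<rho> \<xi> \<mu>) \<Longrightarrow> \<mu> \<in> le1_minimal \<rho>"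
  unfolding le1_minimal_def less1_def using le1_imp_le order_le_less by blast

text \<open>A relation reaching past the minimal ordinal \<open>\<gamma> \<oplus> \<one>\<close>
  would, by \<open>le1_initial\<close>, already hold at that ordinal.\<close>

lemma not_le1_across:
  assumes "\<gamma> \<oplus> \<one> \<in> le1_minimal \<rho>" "z \<le> \<gamma>" "\<gamma> < w"
  shows "\<not> le1 \<rho> z w"
proof
  assume "le1 \<rho> z w"
  moreover have "z \<le> \<gamma> \<oplus> \<one>" "\<gamma> \<oplus> \<one> \<le> w" using assms(2,3) by (simp_all add: order_less_imp_le)
  ultimately have "le1 \<rho> z (\<gamma> \<oplus> \<one>)" by (rule le1_initial)
  then have "z = \<gamma> \<oplus> \<one>" using assms(1) minimalD by blast
  moreover have "z < \<gamma> \<oplus> \<one>" using assms(2) by simp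
  ultimately show False by simp
qed

text \<open>Points strictly between \<gamma> and \<open>\<gamma> \<oplus> \<rho>\<close> are not
  multiples of \<rho>, so they are \<open>le1\<close> only themselves; the others fall under
  \<open>not_le1_across\<close>.\<close>

lemma not_le1_across_rho:
  assumes "\<gamma> \<oplus> \<one> \<in> le1_minimal \<rho>" "z < \<gamma> \<oplus> \<rho>" "\<gamma> \<oplus> \<rho> \<le> w"
  shows "\<not> le1 \<rho> z w"
proof (cases "z \<le> \<gamma>")
  case True
  have "\<gamma> < \<gamma> \<oplus> \<rho>" by simp
  then have "\<gamma> < w" using assms(3) by (rule order.strict_trans2)
  then show ?thesis using assms(1) True by (intro not_le1_across)
next
  case False
  then have "\<not> dv z" using assms(2) unfolding dv_iff by (meson linorder_not_le)
  moreover have "z < w" using assms(2,3) by (rule order.strict_trans2)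
  ultimately show ?thesis using le1_less_dv by blast
qed

section \<open>Transfer between two final segments\<close>

text \<open>Restricted to one larger argument v so that it can serve as an induction hypothesis. The
  points \<gamma> and \<gamma>' themselves are excluded by u > 0.\<close>

definition agree :: "'a \<Rightarrow> 'a \<Rightarrow> 'a \<Rightarrow> bool"
  where "agree \<gamma> \<gamma>' v \<longleftrightarrow> (\<forall>u>\<zero>.
    (le1 \<rho> (\<gamma> \<oplus> u) (\<gamma> \<oplus> v) \<longleftrightarrow> le1 \<rho> (\<gamma>' \<oplus> u) (\<gamma>' \<oplus> v)) \<and>
    (le2 \<rho> (\<gamma> \<oplus> u) (\<gamma> \<oplus> v) \<longleftrightarrow> le2 \<rho> (\<gamma>' \<oplus> u) (\<gamma>' \<oplus> v)))"

lemma agree_sym: "agree \<gamma> \<gamma>' v \<longleftrightarrow> agree \<gamma>' \<gamma> v"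
  unfolding agree_def by blast

lemma agree_le1: "agree \<gamma> \<gamma>' v \<Longrightarrow> \<zero> < u \<Longrightarrow>
    le1 \<rho> (\<gamma> \<oplus> u) (\<gamma> \<oplus> v) \<longleftrightarrow> le1 \<rho> (\<gamma>' \<oplus> u) (\<gamma>' \<oplus> v)"
  unfolding agree_def by blast

lemma agree_le2: "agree \<gamma> \<gamma>' v \<Longrightarrow> \<zero> < u \<Longrightarrow>
    le2 \<rho> (\<gamma> \<oplus> u) (\<gamma> \<oplus> v) \<longleftrightarrow> le2 \<rho> (\<gamma>' \<oplus> u) (\<gamma>' \<oplus> v)"
  unfolding agree_def by blast

lemma rho_le_pos: "\<rho> \<le> u \<Longrightarrow> \<zero> < u"
  using rho_pos by (rule order.strict_trans2)

lemma f_xi_eq_shift_iff: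
  assumes "\<rho> \<le> u"
  shows "f_xi \<rho> \<xi> (\<gamma> \<oplus> u) = \<gamma> \<oplus> v \<longleftrightarrow> f_xi \<rho> \<xi> u = v"
  by (simp add: f_xi_shift[OF assms])

text \<open>The part of \<open>Z\<close> below \<open>\<gamma>' \<oplus> \<rho>\<close> can be left fixed: as \<open>\<gamma>' \<oplus> \<one>\<close> is minimal, nothing
  there is \<open>\<le>\<^sub>1\<close>-related to anything above, and \<open>\<gamma>' \<oplus> \<rho>\<close> is divisible by \<open>\<rho>\<close>.\<close>

lemma transfer:
  assumes minimal: "\<gamma>' \<oplus> \<one> \<in> le1_minimal \<rho>"
    and agree_below: "\<forall>v<y. agree \<gamma> \<gamma>' v"
    and Z: "Z \<subseteq> {..<\<gamma>' \<oplus> y}" and U: "U = {u. \<rho> \<le> u \<and> \<gamma>' \<oplus> u \<in> Z}"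
    and g: "cover g ((\<oplus>) \<gamma> ` U)"
    and g_range: "\<forall>u\<in>U. \<gamma> \<oplus> \<rho> \<le> g (\<gamma> \<oplus> u) \<and> g (\<gamma> \<oplus> u) < \<gamma> \<oplus> y"
  shows "\<exists>g'. cover g' Z \<and> (\<forall>z\<in>Z. z < \<gamma>' \<oplus> \<rho> \<longrightarrow> g' z = z) \<and>
    (\<forall>u\<in>U. \<exists>w. \<rho> \<le> w \<and> w < y \<and> g (\<gamma> \<oplus> u) = \<gamma> \<oplus> w \<and> g' (\<gamma>' \<oplus> u) = \<gamma>' \<oplus> w)"
proof -
  have agree: "agree \<gamma> \<gamma>' v" if "v < y" for v using agree_below that by blast
  have "\<exists>w. \<rho> \<le> w \<and> w < y \<and> g (\<gamma> \<oplus> u) = \<gamma> \<oplus> w" if "u \<in> U" for u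
  proof -
    have "\<gamma> \<le> g (\<gamma> \<oplus> u)" using oadd_ge_left g_range that order_trans by blast
    then obtain w where "g (\<gamma> \<oplus> u) = \<gamma> \<oplus> w" by (rule le_oadd_cases)
    then show ?thesis using g_range that by force
  qed
  \<comment> \<open>The map k is g read in coordinates relative to \<gamma>.\<close>
  then obtain k where k: "\<And>u. u \<in> U \<Longrightarrow> \<rho> \<le> k u \<and> k u < y \<and> g (\<gamma> \<oplus> u) = \<gamma> \<oplus> k u" by metis
  have U_less: "\<rho> \<le> u \<and> u < y" if "u \<in> U" for u using that Z unfolding U by auto
  have k_mono: "k u < k v \<longleftrightarrow> u < v" if "u \<in> U" "v \<in> U" for u v
    using cover_mono[OF g, of "\<gamma> \<oplus> u" "\<gamma> \<oplus> v"] k that by simp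
  have k_f: "f_xi \<rho> \<xi> u = v \<longleftrightarrow> f_xi \<rho> \<xi> (k u) = k v" if "u \<in> U" "v \<in> U" "\<xi> < \<rho>" for u v \<xi>
  proof -
    have "f_xi \<rho> \<xi> (\<gamma> \<oplus> u) = \<gamma> \<oplus> v \<longleftrightarrow> f_xi \<rho> \<xi> (g (\<gamma> \<oplus> u)) = g (\<gamma> \<oplus> v)"
      using g that unfolding covering_map_def by blast
    then show ?thesis using that k U_less by (simp add: f_xi_eq_shift_iff)
  qed
  \<comment> \<open>The relation moves to \<gamma> by agreement at v, passes through g, and returns
    by agreement at \<open>k v\<close>; both arguments are below y.\<close>
  have k_le1: "le1 \<rho> (\<gamma>' \<oplus> k u) (\<gamma>' \<oplus> k v)" if "u \<in> U" "v \<in> U" "le1 \<rho> (\<gamma>' \<oplus> u) (\<gamma>' \<oplus> v)" for u v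
  proof -
    have "le1 \<rho> (\<gamma> \<oplus> u) (\<gamma> \<oplus> v)"
      using agree_le1[OF agree, of v u] that U_less rho_le_pos by blast
    then have "le1 \<rho> (g (\<gamma> \<oplus> u)) (g (\<gamma> \<oplus> v))" using g that unfolding covering_map_def by blast
    then show ?thesis using agree_le1[OF agree, of "k v" "k u"] that k rho_le_pos by simp
  qed
  have k_le2: "le2 \<rho> (\<gamma>' \<oplus> k u) (\<gamma>' \<oplus> k v)" if "u \<in> U" "v \<in> U" "le2 \<rho> (\<gamma>' \<oplus> u) (\<gamma>' \<oplus> v)" for u v
  proof -
    have "le2 \<rho> (\<gamma> \<oplus> u) (\<gamma> \<oplus> v)"
      using agree_le2[OF agree, of v u] that U_less rho_le_pos by blast
    then have "le2 \<rho> (g (\<gamma> \<oplus> u)) (g (\<gamma> \<oplus> v))" using g that unfolding covering_map_def by blast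
    then show ?thesis using agree_le2[OF agree, of "k v" "k u"] that k rho_le_pos by simp
  qed
  \<comment> \<open>Identity below the cut, glued to k in coordinates relative to \<gamma>'.\<close>
  define g' where "g' z = (if z < \<gamma>' \<oplus> \<rho> then z else \<gamma>' \<oplus> k (THE u. z = \<gamma>' \<oplus> u))" for z
  have low: "g' z = z" if "z < \<gamma>' \<oplus> \<rho>" for z using that by (simp add: g'_def)
  have high: "g' (\<gamma>' \<oplus> u) = \<gamma>' \<oplus> k u" if "u \<in> U" for u
  proof -
    have "\<not> \<gamma>' \<oplus> u < \<gamma>' \<oplus> \<rho>" using U_less[OF that] by (simp add: not_less)
    then show ?thesis by (simp add: g'_def)
  qed
  have cases: "z < \<gamma>' \<oplus> \<rho> \<or> (\<exists>u\<in>U. z = \<gamma>' \<oplus> u)" if "z \<in> Z" for z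
  proof (cases "z < \<gamma>' \<oplus> \<rho>")
    case False
    then have ge: "\<gamma>' \<oplus> \<rho> \<le> z" by simp
    then have "\<gamma>' \<le> z" using oadd_ge_left order_trans by blast
    then obtain u where "z = \<gamma>' \<oplus> u" by (rule le_oadd_cases)
    then show ?thesis using that ge unfolding U by auto
  qed simp
  \<comment> \<open>Since the cut is a multiple of \<rho>, no \<open>f_xi\<close> relates the two
    glued parts.\<close>
  have dv: "dv (\<gamma>' \<oplus> \<rho>)" by (simp add: dv_shift)
  have ge: "\<gamma>' \<oplus> \<rho> \<le> \<gamma>' \<oplus> u" "\<gamma>' \<oplus> \<rho> \<le> \<gamma>' \<oplus> k u" if "u \<in> U" for u
    using U_less[OF that] k[OF that] by auto
  have "cover g' Z"
    unfolding covering_map_def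
  proof (intro conjI allI impI ballI strict_mono_onI)
    fix x y assume xy: "x \<in> Z" "y \<in> Z"
    note cs = cases[OF xy(1)] cases[OF xy(2)]
    show "g' x < g' y" if "x < y"
    proof (cases "x < \<gamma>' \<oplus> \<rho>")
      case True
      then have "x < g' y" if "y = \<gamma>' \<oplus> u" "u \<in> U" for u
        using that ge(2) high by (metis order.strict_trans2)
      then show ?thesis using cs(2) \<open>x < y\<close> True by (auto simp: low)
    next
      case False
      then have "\<not> y < \<gamma>' \<oplus> \<rho>" using that by (meson order.strict_trans)
      then show ?thesis using False cs that by (auto simp: high k_mono)
    qed
    show "f_xi \<rho> \<xi> x = y \<longleftrightarrow> f_xi \<rho> \<xi> (g' x) = g' y" if "\<xi> < \<rho>" for \<xi>
    proof (cases "x < \<gamma>' \<oplus> \<rho>")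
      case True
      then have "\<not> \<gamma>' \<oplus> \<rho> \<le> f_xi \<rho> \<xi> x" using dv_le_f_xi_iff[OF dv that] by (meson linorder_not_le)
      then have "f_xi \<rho> \<xi> x \<noteq> \<gamma>' \<oplus> u \<and> f_xi \<rho> \<xi> x \<noteq> \<gamma>' \<oplus> k u" if "u \<in> U" for u
        using ge[OF that] by metis
      then show ?thesis using cs(2) True by (metis high low)
    next
      case False
      then obtain u where u: "u \<in> U" "x = \<gamma>' \<oplus> u" using cs(1) by blast
      then have "\<gamma>' \<oplus> \<rho> \<le> f_xi \<rho> \<xi> (\<gamma>' \<oplus> u)" "\<gamma>' \<oplus> \<rho> \<le> f_xi \<rho> \<xi> (\<gamma>' \<oplus> k u)"
        using dv_le_f_xi_iff[OF dv that] ge by blast+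
      then have "f_xi \<rho> \<xi> (\<gamma>' \<oplus> u) \<noteq> y" "f_xi \<rho> \<xi> (\<gamma>' \<oplus> k u) \<noteq> y" if "y < \<gamma>' \<oplus> \<rho>"
        using that by (meson linorder_not_le)+
      moreover have "f_xi \<rho> \<xi> (\<gamma>' \<oplus> u) = \<gamma>' \<oplus> v \<longleftrightarrow> f_xi \<rho> \<xi> (\<gamma>' \<oplus> k u) = \<gamma>' \<oplus> k v" if "v \<in> U" for v
        using u(1) that U_less k k_f \<open>\<xi> < \<rho>\<close> by (simp add: f_xi_eq_shift_iff)
      ultimately show ?thesis using cs(2) u by (metis high low)
    qed
    show "le1 \<rho> (g' x) (g' y)" if "le1 \<rho> x y"
    proof (cases "y < \<gamma>' \<oplus> \<rho>")
      case True
      then have "x < \<gamma>' \<oplus> \<rho>" using that le1_imp_le by (meson order.strict_trans1)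
      then show ?thesis using True that by (simp add: low)
    next
      case False
      then have "\<not> x < \<gamma>' \<oplus> \<rho>" using that not_le1_across_rho[OF minimal] by (meson linorder_not_le)
      then show ?thesis using False cs that k_le1 by (auto simp: high)
    qed
    show "le2 \<rho> (g' x) (g' y)" if "le2 \<rho> x y"
    proof (cases "y < \<gamma>' \<oplus> \<rho>")
      case True
      then have "x < \<gamma>' \<oplus> \<rho>" using that le2_imp_le1 le1_imp_le by (meson order.strict_trans1)
      then show ?thesis using True that by (simp add: low)
    next
      case False
      then have "\<not> x < \<gamma>' \<oplus> \<rho>"
        using that le2_imp_le1 not_le1_across_rho[OF minimal] by (meson linorder_not_le)
      then show ?thesis using False cs that k_le2 by (auto simp: high)
    qed
  qed
  then show ?thesis using low high k by metis
qed

text \<open>The multiple at the start of a block meeting the ordinals from \<rho> on is itself at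
  least \<rho>, so closedness is not lost at the cut.\<close>

lemma rho_closed_shift:
  assumes "rho_closed \<rho> Z"
  shows "rho_closed \<rho> ((\<oplus>) \<gamma> ` {u. \<rho> \<le> u \<and> \<gamma>' \<oplus> u \<in> Z})"
  unfolding rho_closed_def
proof (intro allI impI, elim conjE exE)
  fix \<sigma> \<xi> assume \<sigma>: "dv \<sigma>" "\<xi> < \<rho>" and "\<sigma> \<oplus> \<xi> \<in> (\<oplus>) \<gamma> ` {u. \<rho> \<le> u \<and> \<gamma>' \<oplus> u \<in> Z}"
  then obtain u where u: "\<sigma> \<oplus> \<xi> = \<gamma> \<oplus> u" "\<rho> \<le> u" "\<gamma>' \<oplus> u \<in> Z" by blast
  obtain \<tau> \<epsilon> where t: "dv \<tau>" "\<epsilon> < \<rho>" "u = \<tau> \<oplus> \<epsilon>" by (rule decompose)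
  then have ge: "\<rho> \<le> \<tau>" using u(2) by (simp add: dv_le_oadd_iff)
  have "\<gamma>' \<oplus> \<tau> \<in> Z"
    by (rule rho_closedD[OF assms _ t(2)]) (use u t ge in \<open>simp_all add: dv_shift oadd_assoc\<close>)
  moreover have "\<sigma> = \<gamma> \<oplus> \<tau>"
    using decompose_unique[of \<sigma> "\<gamma> \<oplus> \<tau>" \<xi> \<epsilon>] \<sigma> t u(1) ge by (simp add: dv_shift oadd_assoc)
  ultimately show "\<sigma> \<in> (\<oplus>) \<gamma> ` {u. \<rho> \<le> u \<and> \<gamma>' \<oplus> u \<in> Z}" using ge by blast
qed

lemma finite_shift: "finite Z \<Longrightarrow> finite {u. \<rho> \<le> u \<and> \<gamma> \<oplus> u \<in> Z}"
  by (rule finite_subset[OF _ finite_vimageI[of Z "(\<oplus>) \<gamma>"]]) (auto simp: inj_def)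

text \<open>P and Q stand for being \<open>le1\<close> the larger and the smaller argument in the
  downward clause; taking them trivial gives the clause of \<open>le1\<close>.\<close>

lemma reflects_transfer:
  assumes minimal: "\<gamma>' \<oplus> \<one> \<in> le1_minimal \<rho>"
    and agree_below: "\<forall>v<y. agree \<gamma> \<gamma>' v"
    and x: "\<rho> < x" "x < y"
    and reflects: "\<And>Z. finite Z \<Longrightarrow> Z \<subseteq> {..<\<gamma> \<oplus> y} \<Longrightarrow> rho_closed \<rho> Z \<Longrightarrow>
        \<exists>g. reflects (\<gamma> \<oplus> x) Z g \<and> (\<forall>z\<in>Z. \<gamma> \<oplus> x \<le> z \<longrightarrow> P z \<longrightarrow> Q (g z))"
    and P: "\<And>u. \<zero> < u \<Longrightarrow> P' (\<gamma>' \<oplus> u) \<Longrightarrow> P (\<gamma> \<oplus> u)"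
    and Q: "\<And>u. \<zero> < u \<Longrightarrow> Q (\<gamma> \<oplus> u) \<Longrightarrow> Q' (\<gamma>' \<oplus> u)"
    and Z: "finite Z" "Z \<subseteq> {..<\<gamma>' \<oplus> y}" "rho_closed \<rho> Z"
  shows "\<exists>g. reflects (\<gamma>' \<oplus> x) Z g \<and> (\<forall>z\<in>Z. \<gamma>' \<oplus> x \<le> z \<longrightarrow> P' z \<longrightarrow> Q' (g z))"
proof -
  \<comment> \<open>Adjoining \<open>\<gamma>' \<oplus> \<rho>\<close> forces the reflected points to stay above \<open>\<gamma> \<oplus> \<rho>\<close>.\<close>
  define Z1 where "Z1 = insert (\<gamma>' \<oplus> \<rho>) Z"
  define U where "U = {u. \<rho> \<le> u \<and> \<gamma>' \<oplus> u \<in> Z1}"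
  have "\<rho> < y" using x by (rule order.strict_trans)
  then have Z1: "finite Z1" "Z1 \<subseteq> {..<\<gamma>' \<oplus> y}" "rho_closed \<rho> Z1"
    unfolding Z1_def using Z by (simp_all add: rho_closed_insert dv_shift)
  have U_less: "\<rho> \<le> u \<and> u < y" if "u \<in> U" for u using that Z1(2) unfolding U_def by auto
  have W: "rho_closed \<rho> ((\<oplus>) \<gamma> ` U)" "finite ((\<oplus>) \<gamma> ` U)" "(\<oplus>) \<gamma> ` U \<subseteq> {..<\<gamma> \<oplus> y}"
  proof -
    show "rho_closed \<rho> ((\<oplus>) \<gamma> ` U)" unfolding U_def by (rule rho_closed_shift[OF Z1(3)])
    show "finite ((\<oplus>) \<gamma> ` U)" unfolding U_def by (intro finite_imageI finite_shift Z1(1))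
    show "(\<oplus>) \<gamma> ` U \<subseteq> {..<\<gamma> \<oplus> y}" using U_less by (auto simp del: less_oadd_iff)
  qed
  obtain g where g: "reflects (\<gamma> \<oplus> x) ((\<oplus>) \<gamma> ` U) g"
    "\<forall>z\<in>(\<oplus>) \<gamma> ` U. \<gamma> \<oplus> x \<le> z \<longrightarrow> P z \<longrightarrow> Q (g z)"
    using reflects[OF W(2,3,1)] by blast
  have cover: "cover g ((\<oplus>) \<gamma> ` U)" using g unfolding reflects_def by blast
  have g_less: "g (\<gamma> \<oplus> u) < \<gamma> \<oplus> x" if "u \<in> U" for u using g that unfolding reflects_def by auto
  have g_id: "g (\<gamma> \<oplus> u) = \<gamma> \<oplus> u" if "u \<in> U" "u < x" for u using g that unfolding reflects_def by auto
  have rho: "\<rho> \<in> U" unfolding U_def Z1_def by simp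
  have g_range: "\<forall>u\<in>U. \<gamma> \<oplus> \<rho> \<le> g (\<gamma> \<oplus> u) \<and> g (\<gamma> \<oplus> u) < \<gamma> \<oplus> y"
  proof (intro ballI conjI)
    fix u assume that: "u \<in> U"
    have "\<not> g (\<gamma> \<oplus> u) < g (\<gamma> \<oplus> \<rho>)"
      using cover_mono[OF cover, of "\<gamma> \<oplus> u" "\<gamma> \<oplus> \<rho>"] that rho U_less[OF that] by (simp add: not_less)
    then show "\<gamma> \<oplus> \<rho> \<le> g (\<gamma> \<oplus> u)" using g_id[OF rho x(1)] by (simp add: not_less)
    show "g (\<gamma> \<oplus> u) < \<gamma> \<oplus> y"
      by (rule order.strict_trans[OF g_less[OF that]]) (use x in simp)
  qed
  obtain g' where g': "cover g' Z1" "\<And>z. z \<in> Z1 \<Longrightarrow> z < \<gamma>' \<oplus> \<rho> \<Longrightarrow> g' z = z"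
    "\<And>u. u \<in> U \<Longrightarrow> \<exists>w. \<rho> \<le> w \<and> w < y \<and> g (\<gamma> \<oplus> u) = \<gamma> \<oplus> w \<and> g' (\<gamma>' \<oplus> u) = \<gamma>' \<oplus> w"
    using transfer[OF minimal agree_below Z1(2) U_def cover g_range] by blast
  have cases: "z < \<gamma>' \<oplus> \<rho> \<or> (\<exists>u\<in>U. z = \<gamma>' \<oplus> u)" if "z \<in> Z" for z
  proof (cases "z < \<gamma>' \<oplus> \<rho>")
    case False
    then have ge: "\<gamma>' \<oplus> \<rho> \<le> z" by simp
    then have "\<gamma>' \<le> z" using oadd_ge_left order_trans by blast
    then obtain u where "z = \<gamma>' \<oplus> u" by (rule le_oadd_cases)
    then show ?thesis using that ge unfolding U_def Z1_def by auto
  qed simp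
  have rx: "\<gamma>' \<oplus> \<rho> < \<gamma>' \<oplus> x" using x by simp
  have *: "g' z < \<gamma>' \<oplus> x \<and> (z < \<gamma>' \<oplus> x \<longrightarrow> g' z = z) \<and> (\<gamma>' \<oplus> x \<le> z \<longrightarrow> P' z \<longrightarrow> Q' (g' z))"
    if z: "z \<in> Z" for z
  proof (cases "z < \<gamma>' \<oplus> \<rho>")
    case True
    then have "z < \<gamma>' \<oplus> x" using rx by (rule order.strict_trans)
    then show ?thesis using g'(2) z True unfolding Z1_def by auto
  next
    case False
    then obtain u where u: "u \<in> U" "z = \<gamma>' \<oplus> u" using cases[OF z] by blast
    then obtain w where w: "\<rho> \<le> w" "g (\<gamma> \<oplus> u) = \<gamma> \<oplus> w" "g' (\<gamma>' \<oplus> u) = \<gamma>' \<oplus> w"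
      using g'(3)[OF u(1)] by blast
    have "w < x" using g_less[OF u(1)] w by simp
    moreover have "u < x \<longrightarrow> w = u" using g_id[OF u(1)] w(2) by simp
    \<comment> \<open>The condition travels as the point does: from \<gamma>' to \<gamma> at u, then
      back at the image w.\<close>
    moreover have "x \<le> u \<longrightarrow> P' z \<longrightarrow> Q' (g' z)"
    proof (intro impI)
      assume "x \<le> u" "P' z"
      then have "P (\<gamma> \<oplus> u)" using P[of u] U_less[OF u(1)] rho_le_pos[of u] u(2) by simp
      then have "Q (\<gamma> \<oplus> w)" using g(2) u(1) \<open>x \<le> u\<close> unfolding w(2)[symmetric] by simp
      then show "Q' (g' z)" using Q[of w] rho_le_pos[OF w(1)] u(2) w(3) by simp
    qed
    ultimately show ?thesis using u(2) w(3) by simp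
  qed
  have "cover g' Z" using g'(1) cover_subset unfolding Z1_def by blast
  then show ?thesis using * unfolding reflects_def by (intro exI[of _ g']) auto
qed

section \<open>The upward clause of \<open>le2\<close>\<close>

lemma cofinally_comp:
  assumes e: "cover e (X \<union> Y)" "\<forall>x\<in>X. e x = x" and cofinal: "cofinally X (e ` Y) \<alpha>"
  shows "cofinally X Y \<alpha>"
  unfolding cofinally_def
proof (intro allI impI)
  fix \<delta> assume "\<delta> < \<alpha>"
  then obtain g where g: "cover g (X \<union> e ` Y)" "\<forall>x\<in>X. g x = x" "g ` e ` Y \<subseteq> {\<delta><..<\<alpha>}"
    using cofinal unfolding cofinally_def by blast
  have "e ` (X \<union> Y) = X \<union> e ` Y" using e(2) by force
  then have "cover (\<lambda>z. g (e z)) (X \<union> Y)" using cover_comp[of e "X \<union> Y" g] e(1) g(1) by simp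
  moreover have "\<forall>x\<in>X. g (e x) = x" using e(2) g(2) by simp
  moreover have "(\<lambda>z. g (e z)) ` Y \<subseteq> {\<delta><..<\<alpha>}" using g(3) by (simp add: image_image)
  ultimately show "\<exists>g. cover g (X \<union> Y) \<and> (\<forall>x\<in>X. g x = x) \<and> g ` Y \<subseteq> {\<delta><..<\<alpha>}"
    by (intro exI[of _ "\<lambda>z. g (e z)"]) simp
qed

text \<open>One of the finitely many patterns of \<open>\<le>\<^sub>1\<close> and \<open>\<le>\<^sub>2\<close> on the copies of \<open>X \<union> Y\<close> occurs
  cofinally, and a copy with that pattern is again covered by cofinally many copies.\<close>

lemma cofinal_copy:
  assumes fin: "finite X" "finite Y" and cofinal: "cofinally X Y \<alpha>" and \<delta>: "\<delta> < \<alpha>"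
  obtains e where "cover e (X \<union> Y)" "\<forall>x\<in>X. e x = x" "e ` Y \<subseteq> {\<delta><..<\<alpha>}" "cofinally X (e ` Y) \<alpha>"
proof -
  define Z where "Z = X \<union> Y"
  have "\<exists>g. cover g Z \<and> (\<forall>x\<in>X. g x = x) \<and> g ` Y \<subseteq> {d<..<\<alpha>}" if "d < \<alpha>" for d
    using cofinal that unfolding cofinally_def Z_def by blast
  then obtain g where g: "\<And>d. d < \<alpha> \<Longrightarrow> cover (g d) Z"
    "\<And>d x. d < \<alpha> \<Longrightarrow> x \<in> X \<Longrightarrow> g d x = x" "\<And>d. d < \<alpha> \<Longrightarrow> g d ` Y \<subseteq> {d<..<\<alpha>}" by metis
  \<comment> \<open>The pattern is recorded on Z itself, so only finitely many are possible. Order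
    and \<open>f_xi\<close> need no record, since coverings preserve and reflect them.\<close>
  define P where "P d = (\<lambda>R. {(u, v). u \<in> Z \<and> v \<in> Z \<and> R (g d u) (g d v)})" for d
  define PP where "PP d = (P d (le1 \<rho>), P d (le2 \<rho>))" for d
  have "PP ` {..<\<alpha>} \<subseteq> Pow (Z \<times> Z) \<times> Pow (Z \<times> Z)" unfolding PP_def P_def by auto
  moreover have "finite (Pow (Z \<times> Z) \<times> Pow (Z \<times> Z))" using fin unfolding Z_def by simp
  ultimately have "finite (PP ` {..<\<alpha>})" by (rule finite_subset)
  moreover have "\<zero> < \<alpha>" using ozero_le \<delta> by (rule order.strict_trans1)
  ultimately obtain p where p: "\<And>d. d < \<alpha> \<Longrightarrow> \<exists>d'. d \<le> d' \<and> d' < \<alpha> \<and> PP d' = p"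
    using cofinal_pigeonhole by metis
  obtain d0 where d0: "\<delta> \<le> d0" "d0 < \<alpha>" "PP d0 = p" using p[OF \<delta>] by blast
  define e where "e = g d0"
  have e: "cover e Z" "\<forall>x\<in>X. e x = x" "e ` Y \<subseteq> {d0<..<\<alpha>}" unfolding e_def using g d0(2) by auto
  have inj: "inj_on e Z" using e(1) unfolding covering_map_def by (blast intro: strict_mono_on_imp_inj_on)
  have eZ: "e ` Z = X \<union> e ` Y" unfolding Z_def using e(2) by force
  have "cofinally X (e ` Y) \<alpha>"
    unfolding cofinally_def eZ[symmetric]
  proof (intro allI impI)
    fix d assume "d < \<alpha>"
    then obtain d1 where d1: "d \<le> d1" "d1 < \<alpha>" "PP d1 = p" using p by blast
    \<comment> \<open>This leads from the chosen copy to a later copy. Equality of the two patterns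
      makes it a covering even where the copy has more relations than Z.\<close>
    define h where "h z = g d1 (inv_into Z e z)" for z
    have h: "h (e z) = g d1 z" if "z \<in> Z" for z using that inj by (simp add: h_def)
    note cov = g(1)[OF d1(2)]
    have "P d0 R = P d1 R" if "R = le1 \<rho> \<or> R = le2 \<rho>" for R
      using that d0(3) d1(3) unfolding PP_def by auto
    then have pattern: "R (e u) (e v) \<longleftrightarrow> R (g d1 u) (g d1 v)"
      if "R = le1 \<rho> \<or> R = le2 \<rho>" "u \<in> Z" "v \<in> Z" for R u v
      using that unfolding P_def e_def by blast
    have "cover h (e ` Z)"
      unfolding covering_map_def
    proof (intro conjI allI impI ballI strict_mono_onI; elim imageE; hypsubst)
      fix u v assume uv: "u \<in> Z" "v \<in> Z"
      show "h (e u) < h (e v)" if "e u < e v"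
        using that uv cover_mono[OF cov] cover_mono[OF e(1)] by (simp add: h)
      show "f_xi \<rho> \<xi> (e u) = e v \<longleftrightarrow> f_xi \<rho> \<xi> (h (e u)) = h (e v)" if "\<xi> < \<rho>" for \<xi>
      proof -
        have "f_xi \<rho> \<xi> u = v \<longleftrightarrow> f_xi \<rho> \<xi> (e u) = e v"
          "f_xi \<rho> \<xi> u = v \<longleftrightarrow> f_xi \<rho> \<xi> (g d1 u) = g d1 v"
          using cov e(1) uv that unfolding covering_map_def by blast+
        then show ?thesis using uv by (simp add: h)
      qed
      show "le1 \<rho> (h (e u)) (h (e v))" if "le1 \<rho> (e u) (e v)"
        using that uv pattern[of "le1 \<rho>" u v] by (simp add: h)
      show "le2 \<rho> (h (e u)) (h (e v))" if "le2 \<rho> (e u) (e v)"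
        using that uv pattern[of "le2 \<rho>" u v] by (simp add: h)
    qed
    moreover have "\<forall>x\<in>X. h x = x"
    proof
      fix x assume x: "x \<in> X"
      then have "x \<in> Z" "e x = x" using e(2) unfolding Z_def by auto
      then show "h x = x" using h[of x] g(2)[OF d1(2) x] by simp
    qed
    moreover have "h ` e ` Y \<subseteq> {d<..<\<alpha>}"
    proof -
      have "h ` e ` Y = g d1 ` Y" unfolding image_image by (rule image_cong) (simp_all add: h Z_def)
      moreover have "{d1<..<\<alpha>} \<subseteq> {d<..<\<alpha>}" using d1(1) by auto
      ultimately show ?thesis using g(3)[OF d1(2)] by blast
    qed
    ultimately show "\<exists>g. cover g (e ` Z) \<and> (\<forall>x\<in>X. g x = x) \<and> g ` e ` Y \<subseteq> {d<..<\<alpha>}" by blast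
  qed
  moreover have "{d0<..<\<alpha>} \<subseteq> {\<delta><..<\<alpha>}" using d0(1) by auto
  ultimately show thesis using that[of e] e unfolding Z_def by blast
qed

text \<open>The part of X and of the copy of Y beyond the cut is moved from \<gamma>' to \<gamma>,
  the hypothesis is applied there, and the resulting coverings are moved back. Without the copy,
  elements of Y below the cut would stay fixed, although they must move cofinally.\<close>

lemma le2_up_transfer:
  assumes minimal: "\<gamma> \<oplus> \<one> \<in> le1_minimal \<rho>" "\<gamma>' \<oplus> \<one> \<in> le1_minimal \<rho>"
    and agree_below: "\<forall>v<y. agree \<gamma> \<gamma>' v"
    and x: "\<rho> < x" "x < y"
    and up: "\<And>X Y. finite X \<and> X \<subseteq> {..<\<gamma> \<oplus> x} \<and> finite Y \<and> Y \<subseteq> {..<\<gamma> \<oplus> x} \<and>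
        rho_closed \<rho> (X \<union> Y) \<and> set_less X Y \<Longrightarrow>
      cofinally X Y (\<gamma> \<oplus> x) \<Longrightarrow> cofinally X Y (\<gamma> \<oplus> y)"
    and X: "finite X" "X \<subseteq> {..<\<gamma>' \<oplus> x}" and Y: "finite Y" "Y \<subseteq> {..<\<gamma>' \<oplus> x}"
    and closed: "rho_closed \<rho> (X \<union> Y)" and less: "set_less X Y"
    and cofinal: "cofinally X Y (\<gamma>' \<oplus> x)"
  shows "cofinally X Y (\<gamma>' \<oplus> y)"
proof -
  have rx: "\<gamma>' \<oplus> \<rho> < \<gamma>' \<oplus> x" using x by simp
  obtain e where e: "cover e (X \<union> Y)" "\<forall>x\<in>X. e x = x" "e ` Y \<subseteq> {\<gamma>' \<oplus> \<rho><..<\<gamma>' \<oplus> x}"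
    "cofinally X (e ` Y) (\<gamma>' \<oplus> x)"
    using cofinal_copy[OF X(1) Y(1) cofinal rx] by blast
  define Y1 where "Y1 = e ` Y"
  define Z where "Z = X \<union> Y1"
  define U where "U = {u. \<rho> \<le> u \<and> \<gamma>' \<oplus> u \<in> Z}"
  define V where "V = {u. \<rho> \<le> u \<and> \<gamma>' \<oplus> u \<in> X}"
  define W where "W = {u. \<rho> \<le> u \<and> \<gamma>' \<oplus> u \<in> Y1}"
  have Z_image: "Z = e ` (X \<union> Y)" unfolding Z_def Y1_def using e(2) by force
  have Z_closed: "rho_closed \<rho> Z" unfolding Z_image by (rule rho_closed_image[OF e(1) closed])
  have less1: "set_less X Y1"
    using less cover_mono[OF e(1)] e(2) unfolding set_less_def Y1_def by fastforce
  have Y1: "finite Y1" "Y1 \<subseteq> {\<gamma>' \<oplus> \<rho><..<\<gamma>' \<oplus> x}" using Y e(3) unfolding Y1_def by auto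
  have Zx: "Z \<subseteq> {..<\<gamma>' \<oplus> x}" using X(2) Y1(2) unfolding Z_def by auto
  have U_split: "U = V \<union> W" unfolding U_def V_def W_def Z_def by auto
  then have VU: "u \<in> U" if "u \<in> V" for u using that by simp
  have WU: "u \<in> U" if "u \<in> W" for u using U_split that by simp
  have U_less: "\<rho> \<le> u" "u < x" if "u \<in> U" for u using that Zx unfolding U_def by auto
  have xy: "\<delta> \<oplus> x < \<delta> \<oplus> y" for \<delta> using x(2) by simp
  \<comment> \<open>Lower bounds \<delta> may be taken of the form \<open>\<mu> \<oplus> d\<close>
    with d at least \<rho>, which makes sense for both translations.\<close>
  have base: "\<exists>d. \<rho> \<le> d \<and> d < v \<and> \<delta> \<le> \<mu> \<oplus> d" if "\<delta> < \<mu> \<oplus> v" "\<rho> < v" for \<delta> \<mu> v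
  proof (cases "\<delta> \<le> \<mu> \<oplus> \<rho>")
    case False
    then have "\<mu> \<oplus> \<rho> \<le> \<delta>" by simp
    then have "\<mu> \<le> \<delta>" using oadd_ge_left order_trans by blast
    then obtain d where "\<delta> = \<mu> \<oplus> d" by (rule le_oadd_cases)
    then show ?thesis using that \<open>\<mu> \<oplus> \<rho> \<le> \<delta>\<close> by (intro exI[of _ d]) simp
  qed (use that in blast)
  have union: "(\<oplus>) \<mu> ` V \<union> (\<oplus>) \<mu> ` W = (\<oplus>) \<mu> ` U" for \<mu> unfolding U_split by blast
  \<comment> \<open>Needed to apply \<open>transfer\<close> with \<gamma> and \<gamma>' exchanged:
    the set on the \<gamma> side lies entirely beyond the cut.\<close>
  have U_eq: "U = {u. \<rho> \<le> u \<and> \<gamma> \<oplus> u \<in> (\<oplus>) \<gamma> ` U}" using U_less(1) by auto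
  have \<gamma>U: "(\<oplus>) \<gamma> ` U \<subseteq> {..<\<gamma> \<oplus> x}" using U_less(2) by auto
  have \<gamma>'U: "(\<oplus>) \<gamma>' ` U \<subseteq> Z" unfolding U_def by blast
  have "cofinally ((\<oplus>) \<gamma> ` V) ((\<oplus>) \<gamma> ` W) (\<gamma> \<oplus> x)"
    unfolding cofinally_def union
  proof (intro allI impI)
    fix \<delta> assume "\<delta> < \<gamma> \<oplus> x"
    then obtain d where d: "\<rho> \<le> d" "d < x" "\<delta> \<le> \<gamma> \<oplus> d" using base x(1) by blast
    then have "\<gamma>' \<oplus> d < \<gamma>' \<oplus> x" by simp
    then obtain g where g: "cover g Z" "\<forall>z\<in>X. g z = z" "g ` Y1 \<subseteq> {\<gamma>' \<oplus> d<..<\<gamma>' \<oplus> x}"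
      using e(4) unfolding cofinally_def Z_def Y1_def by blast
    have gV: "g (\<gamma>' \<oplus> u) = \<gamma>' \<oplus> u" if "u \<in> V" for u using g(2) that unfolding V_def by blast
    have gW: "\<gamma>' \<oplus> d < g (\<gamma>' \<oplus> u)" "g (\<gamma>' \<oplus> u) < \<gamma>' \<oplus> x" if "u \<in> W" for u
      using g(3) that unfolding W_def by auto
    have "\<forall>u\<in>U. \<gamma>' \<oplus> \<rho> \<le> g (\<gamma>' \<oplus> u) \<and> g (\<gamma>' \<oplus> u) < \<gamma>' \<oplus> y"
    proof
      fix u assume u: "u \<in> U"
      show "\<gamma>' \<oplus> \<rho> \<le> g (\<gamma>' \<oplus> u) \<and> g (\<gamma>' \<oplus> u) < \<gamma>' \<oplus> y"
      proof (cases "u \<in> V")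
        case True
        then show ?thesis using gV U_less[OF u] x(2) by (simp add: order.strict_trans[of u x y])
      next
        case False
        then have u: "u \<in> W" using u U_split by blast
        have "\<gamma>' \<oplus> \<rho> \<le> \<gamma>' \<oplus> d" using d(1) by simp
        then have "\<gamma>' \<oplus> \<rho> < g (\<gamma>' \<oplus> u)" using gW(1)[OF u] by (rule order.strict_trans1)
        moreover have "g (\<gamma>' \<oplus> u) < \<gamma>' \<oplus> y" using gW(2)[OF u] xy by (rule order.strict_trans)
        ultimately show ?thesis by (simp add: order_less_imp_le)
      qed
    qed
    moreover have "\<forall>v<y. agree \<gamma>' \<gamma> v" using agree_below agree_sym by blast
    moreover have "(\<oplus>) \<gamma> ` U \<subseteq> {..<\<gamma> \<oplus> y}" using \<gamma>U xy[of \<gamma>] by force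
    ultimately obtain g' where g': "cover g' ((\<oplus>) \<gamma> ` U)"
      "\<forall>u\<in>U. \<exists>w. \<rho> \<le> w \<and> w < y \<and> g (\<gamma>' \<oplus> u) = \<gamma>' \<oplus> w \<and> g' (\<gamma> \<oplus> u) = \<gamma> \<oplus> w"
      using transfer[OF minimal(1) _ _ U_eq cover_subset[OF g(1) \<gamma>'U]] by blast
    have "g' (\<gamma> \<oplus> u) = \<gamma> \<oplus> u" if uV: "u \<in> V" for u
    proof -
      obtain w where "g (\<gamma>' \<oplus> u) = \<gamma>' \<oplus> w" "g' (\<gamma> \<oplus> u) = \<gamma> \<oplus> w"
        using g'(2) VU[OF uV] by blast
      then show ?thesis using gV[OF uV] by simp
    qed
    moreover have "\<delta> < g' (\<gamma> \<oplus> u) \<and> g' (\<gamma> \<oplus> u) < \<gamma> \<oplus> x" if uW: "u \<in> W" for u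
    proof -
      obtain w where w: "g (\<gamma>' \<oplus> u) = \<gamma>' \<oplus> w" "g' (\<gamma> \<oplus> u) = \<gamma> \<oplus> w"
        using g'(2) WU[OF uW] by blast
      then have "\<gamma> \<oplus> d < \<gamma> \<oplus> w" "w < x" using gW[OF uW] by simp_all
      then show ?thesis using d(3) w(2) by (simp add: order.strict_trans1)
    qed
    ultimately show "\<exists>g. cover g ((\<oplus>) \<gamma> ` U) \<and> (\<forall>x\<in>(\<oplus>) \<gamma> ` V. g x = x) \<and>
        g ` (\<oplus>) \<gamma> ` W \<subseteq> {\<delta><..<\<gamma> \<oplus> x}"
      using g'(1) by (intro exI[of _ g']) auto
  qed
  moreover have "finite ((\<oplus>) \<gamma> ` V) \<and> (\<oplus>) \<gamma> ` V \<subseteq> {..<\<gamma> \<oplus> x} \<and>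
      finite ((\<oplus>) \<gamma> ` W) \<and> (\<oplus>) \<gamma> ` W \<subseteq> {..<\<gamma> \<oplus> x} \<and>
      rho_closed \<rho> ((\<oplus>) \<gamma> ` V \<union> (\<oplus>) \<gamma> ` W) \<and> set_less ((\<oplus>) \<gamma> ` V) ((\<oplus>) \<gamma> ` W)"
  proof (intro conjI)
    show "finite ((\<oplus>) \<gamma> ` V)" unfolding V_def by (intro finite_imageI finite_shift X(1))
    show "finite ((\<oplus>) \<gamma> ` W)" unfolding W_def by (intro finite_imageI finite_shift Y1(1))
    show "(\<oplus>) \<gamma> ` V \<subseteq> {..<\<gamma> \<oplus> x}" "(\<oplus>) \<gamma> ` W \<subseteq> {..<\<gamma> \<oplus> x}"
      using \<gamma>U unfolding union[symmetric] by blast+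
    show "rho_closed \<rho> ((\<oplus>) \<gamma> ` V \<union> (\<oplus>) \<gamma> ` W)"
      unfolding union U_def by (rule rho_closed_shift[OF Z_closed])
    have "u < v" if "u \<in> V" "v \<in> W" for u v
      using that less1 oadd_less_iff[of \<gamma>' u v] unfolding V_def W_def set_less_def by blast
    then show "set_less ((\<oplus>) \<gamma> ` V) ((\<oplus>) \<gamma> ` W)" unfolding set_less_def by simp
  qed
  ultimately have cofinal_y: "cofinally ((\<oplus>) \<gamma> ` V) ((\<oplus>) \<gamma> ` W) (\<gamma> \<oplus> y)" by (intro up)
  have "cofinally X Y1 (\<gamma>' \<oplus> y)"
    unfolding cofinally_def Z_def[symmetric]
  proof (intro allI impI)
    fix \<delta> assume "\<delta> < \<gamma>' \<oplus> y"
    then obtain d where d: "\<rho> \<le> d" "d < y" "\<delta> \<le> \<gamma>' \<oplus> d"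
      using base[OF _ order.strict_trans[OF x]] by blast
    then have "\<gamma> \<oplus> d < \<gamma> \<oplus> y" by simp
    then obtain g where g: "cover g ((\<oplus>) \<gamma> ` U)" "\<forall>z\<in>(\<oplus>) \<gamma> ` V. g z = z"
      "g ` (\<oplus>) \<gamma> ` W \<subseteq> {\<gamma> \<oplus> d<..<\<gamma> \<oplus> y}"
      using cofinal_y unfolding cofinally_def union by blast
    have gV: "g (\<gamma> \<oplus> u) = \<gamma> \<oplus> u" if "u \<in> V" for u using g(2) that by blast
    have gW: "\<gamma> \<oplus> d < g (\<gamma> \<oplus> u)" "g (\<gamma> \<oplus> u) < \<gamma> \<oplus> y" if "u \<in> W" for u
      using g(3) that by (auto simp: image_subset_iff)
    have "\<forall>u\<in>U. \<gamma> \<oplus> \<rho> \<le> g (\<gamma> \<oplus> u) \<and> g (\<gamma> \<oplus> u) < \<gamma> \<oplus> y"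
    proof
      fix u assume u: "u \<in> U"
      show "\<gamma> \<oplus> \<rho> \<le> g (\<gamma> \<oplus> u) \<and> g (\<gamma> \<oplus> u) < \<gamma> \<oplus> y"
      proof (cases "u \<in> V")
        case True
        then show ?thesis using gV U_less[OF u] x(2) by (simp add: order.strict_trans[of u x y])
      next
        case False
        then have u: "u \<in> W" using u U_split by blast
        have "\<gamma> \<oplus> \<rho> \<le> \<gamma> \<oplus> d" using d(1) by simp
        then have "\<gamma> \<oplus> \<rho> < g (\<gamma> \<oplus> u)" using gW(1)[OF u] by (rule order.strict_trans1)
        then show ?thesis using gW(2)[OF u] by (simp add: order_less_imp_le)
      qed
    qed
    moreover have "Z \<subseteq> {..<\<gamma>' \<oplus> y}" using Zx xy[of \<gamma>'] order.strict_trans by blast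
    ultimately obtain g' where g': "cover g' Z" "\<forall>z\<in>Z. z < \<gamma>' \<oplus> \<rho> \<longrightarrow> g' z = z"
      "\<forall>u\<in>U. \<exists>w. \<rho> \<le> w \<and> w < y \<and> g (\<gamma> \<oplus> u) = \<gamma> \<oplus> w \<and> g' (\<gamma>' \<oplus> u) = \<gamma>' \<oplus> w"
      using transfer[OF minimal(2) agree_below _ U_def g(1)] by blast
    \<comment> \<open>Below the cut X is fixed by the gluing, beyond it because g fixes the
      translated part V.\<close>
    have "g' z = z" if z: "z \<in> X" for z
    proof (cases "z < \<gamma>' \<oplus> \<rho>")
      case True
      then show ?thesis using g'(2) z unfolding Z_def by blast
    next
      case False
      then have ge: "\<gamma>' \<oplus> \<rho> \<le> z" by simp
      then have "\<gamma>' \<le> z" using oadd_ge_left order_trans by blast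
      then obtain u where u: "z = \<gamma>' \<oplus> u" by (rule le_oadd_cases)
      then have "u \<in> V" using ge z unfolding V_def by simp
      moreover from this obtain w where "g (\<gamma> \<oplus> u) = \<gamma> \<oplus> w" "g' (\<gamma>' \<oplus> u) = \<gamma>' \<oplus> w"
        using g'(3) VU by blast
      ultimately show ?thesis using gV u by simp
    qed
    moreover have "\<delta> < g' z \<and> g' z < \<gamma>' \<oplus> y" if z: "z \<in> Y1" for z
    proof -
      have "\<gamma>' \<oplus> \<rho> \<le> z" using z Y1(2) by force
      moreover from this have "\<gamma>' \<le> z" using oadd_ge_left order_trans by blast
      then obtain u where u: "z = \<gamma>' \<oplus> u" by (rule le_oadd_cases)
      ultimately have uW: "u \<in> W" using z unfolding W_def by simp
      then obtain w where w: "w < y" "g (\<gamma> \<oplus> u) = \<gamma> \<oplus> w" "g' (\<gamma>' \<oplus> u) = \<gamma>' \<oplus> w"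
        using g'(3) WU[OF uW] by blast
      then have "\<gamma>' \<oplus> d < \<gamma>' \<oplus> w" using gW(1)[OF uW] by simp
      then show ?thesis using d(3) w u by (simp add: order.strict_trans1)
    qed
    ultimately show "\<exists>g. cover g Z \<and> (\<forall>x\<in>X. g x = x) \<and> g ` Y1 \<subseteq> {\<delta><..<\<gamma>' \<oplus> y}"
      using g'(1) by (intro exI[of _ g']) auto
  qed
  \<comment> \<open>Copies of the copy of Y are copies of Y.\<close>
  then show ?thesis using cofinally_comp[OF e(1,2)] unfolding Y1_def by blast
qed

section \<open>Induction on the larger argument\<close>

lemma le1_transfer:
  assumes "\<gamma>' \<oplus> \<one> \<in> le1_minimal \<rho>" "\<forall>v<y. agree \<gamma> \<gamma>' v"
    and "\<zero> < x" and le: "le1 \<rho> (\<gamma> \<oplus> x) (\<gamma> \<oplus> y)"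
  shows "le1 \<rho> (\<gamma>' \<oplus> x) (\<gamma>' \<oplus> y)"
proof (cases "x = y")
  case False
  then have xy: "x < y" using le1_imp_le[OF le] by simp
  \<comment> \<open>A proper relation forces its smaller argument beyond the cut: \<gamma> lies
    below it, and it is a limit of multiples of \<rho>.\<close>
  have "\<gamma> \<oplus> \<rho> < \<gamma> \<oplus> x" by (rule le1_less_limit[OF le]) (use xy assms(3) in simp_all)
  then have x: "\<rho> < x" by simp
  have "\<exists>g. reflects (\<gamma>' \<oplus> x) Z g \<and> (\<forall>z\<in>Z. \<gamma>' \<oplus> x \<le> z \<longrightarrow> True \<longrightarrow> True)"
    if "finite Z" "Z \<subseteq> {..<\<gamma>' \<oplus> y}" "rho_closed \<rho> Z" for Z
    by (rule reflects_transfer[OF assms(1,2) x xy, of "\<lambda>_. True" "\<lambda>_. True"])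
      (use le that in \<open>simp_all add: le1_reflects[of "\<gamma> \<oplus> x"]\<close>)
  then show ?thesis using xy unfolding le1_reflects[of "\<gamma>' \<oplus> x"] by simp
qed simp

lemma le2_transfer:
  assumes minimal: "\<gamma> \<oplus> \<one> \<in> le1_minimal \<rho>" "\<gamma>' \<oplus> \<one> \<in> le1_minimal \<rho>"
    and agree_below: "\<forall>v<y. agree \<gamma> \<gamma>' v"
    and pos: "\<zero> < x" and le: "le2 \<rho> (\<gamma> \<oplus> x) (\<gamma> \<oplus> y)"
  shows "le2 \<rho> (\<gamma>' \<oplus> x) (\<gamma>' \<oplus> y)"
proof (cases "x = y")
  case False
  note le1 = le2_imp_le1[OF le]
  have xy: "x < y" using False le1_imp_le[OF le1] by simp
  have "\<gamma> \<oplus> \<rho> < \<gamma> \<oplus> x" by (rule le1_less_limit[OF le1]) (use xy pos in simp_all)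
  then have x: "\<rho> < x" by simp
  have agree_sym_below: "\<forall>v<y. agree \<gamma>' \<gamma> v" using agree_below agree_sym by blast
  have "\<exists>g. reflects (\<gamma>' \<oplus> x) Z g \<and>
      (\<forall>z\<in>Z. \<gamma>' \<oplus> x \<le> z \<longrightarrow> le1 \<rho> z (\<gamma>' \<oplus> y) \<longrightarrow> le1 \<rho> (g z) (\<gamma>' \<oplus> x))"
    if Z: "finite Z" "Z \<subseteq> {..<\<gamma>' \<oplus> y}" "rho_closed \<rho> Z" for Z
  proof (rule reflects_transfer[OF minimal(2) agree_below x xy _ _ _ Z])
    show "\<exists>g. reflects (\<gamma> \<oplus> x) Z g \<and>
        (\<forall>z\<in>Z. \<gamma> \<oplus> x \<le> z \<longrightarrow> le1 \<rho> z (\<gamma> \<oplus> y) \<longrightarrow> le1 \<rho> (g z) (\<gamma> \<oplus> x))"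
      if "finite Z" "Z \<subseteq> {..<\<gamma> \<oplus> y}" "rho_closed \<rho> Z" for Z
      using le that unfolding le2_reflects[of "\<gamma> \<oplus> x"] by simp
    \<comment> \<open>Agreement at y is not yet available; \<open>le1_transfer\<close> in the
      opposite direction supplies it for \<open>le1\<close>.\<close>
    show "le1 \<rho> (\<gamma> \<oplus> u) (\<gamma> \<oplus> y)" if "\<zero> < u" "le1 \<rho> (\<gamma>' \<oplus> u) (\<gamma>' \<oplus> y)" for u
      using le1_transfer[OF minimal(1) agree_sym_below that] .
    show "le1 \<rho> (\<gamma>' \<oplus> u) (\<gamma>' \<oplus> x)" if "\<zero> < u" "le1 \<rho> (\<gamma> \<oplus> u) (\<gamma> \<oplus> x)" for u
      using that agree_below xy agree_le1 by blast
  qed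
  moreover have "cofinally X Y (\<gamma>' \<oplus> y)"
    if "finite X \<and> X \<subseteq> {..<\<gamma>' \<oplus> x} \<and> finite Y \<and> Y \<subseteq> {..<\<gamma>' \<oplus> x} \<and> rho_closed \<rho> (X \<union> Y) \<and> set_less X Y"
      "cofinally X Y (\<gamma>' \<oplus> x)" for X Y
    by (rule le2_up_transfer[OF minimal agree_below x xy])
      (use le that in \<open>simp_all add: le2_reflects[of "\<gamma> \<oplus> x"]\<close>)
  ultimately show ?thesis using xy unfolding le2_reflects[of "\<gamma>' \<oplus> x"] by simp
qed simp

theorem agree_minimal:
  assumes "\<gamma> \<oplus> \<one> \<in> le1_minimal \<rho>" "\<gamma>' \<oplus> \<one> \<in> le1_minimal \<rho>"
  shows "agree \<gamma> \<gamma>' y"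
proof (induction y rule: less_induct)
  case (less y)
  then have below: "\<forall>v<y. agree \<gamma> \<gamma>' v" "\<forall>v<y. agree \<gamma>' \<gamma> v" using agree_sym by blast+
  show ?case
    unfolding agree_def[of \<gamma> \<gamma>' y]
    using le1_transfer[OF assms(1) below(2)] le1_transfer[OF assms(2) below(1)]
      le2_transfer[OF assms below(1)] le2_transfer[OF assms(2,1) below(2)] by blast
qed

text \<open>Admits zero as one of the two translations in \<open>agree_minimal\<close>.\<close>

lemma one_minimal: "\<one> \<in> le1_minimal \<rho>"
  by (rule minimalI) (simp add: not_zero_le1)

lemma shift_le1_iff:
  assumes "\<gamma> \<oplus> \<one> \<in> le1_minimal \<rho>" "\<zero> < u"
  shows "le1 \<rho> (\<gamma> \<oplus> u) (\<gamma> \<oplus> v) \<longleftrightarrow> le1 \<rho> u v"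
  using agree_le1[OF agree_minimal[OF assms(1), of \<zero>] assms(2), of v] one_minimal by simp

lemma shift_le2_iff:
  assumes "\<gamma> \<oplus> \<one> \<in> le1_minimal \<rho>" "\<zero> < u"
  shows "le2 \<rho> (\<gamma> \<oplus> u) (\<gamma> \<oplus> v) \<longleftrightarrow> le2 \<rho> u v"
  using agree_le2[OF agree_minimal[OF assms(1), of \<zero>] assms(2), of v] one_minimal by simp

text \<open>Witnesses against minimality correspond under translation, except zero on one side and
  the ordinals up to \<gamma> on the other; these are never witnesses.\<close>

lemma shift_minimal_iff:
  assumes "\<gamma> \<oplus> \<one> \<in> le1_minimal \<rho>" "\<zero> < u"
  shows "\<gamma> \<oplus> u \<in> le1_minimal \<rho> \<longleftrightarrow> u \<in> le1_minimal \<rho>"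
proof
  assume g: "\<gamma> \<oplus> u \<in> le1_minimal \<rho>"
  show "u \<in> le1_minimal \<rho>"
  proof (rule minimalI)
    fix \<xi> assume "\<xi> < u"
    show "\<not> le1 \<rho> \<xi> u"
    proof (cases "\<xi> = \<zero>")
      case False
      then show ?thesis
        using minimalD[OF g, of "\<gamma> \<oplus> \<xi>"] \<open>\<xi> < u\<close> shift_le1_iff[OF assms(1), of \<xi> u]
        by (auto simp: ozero_less_iff)
    qed (use assms(2) not_zero_le1 in simp)
  qed
next
  assume u: "u \<in> le1_minimal \<rho>"
  show "\<gamma> \<oplus> u \<in> le1_minimal \<rho>"
  proof (rule minimalI)
    fix \<xi> assume \<xi>: "\<xi> < \<gamma> \<oplus> u"
    show "\<not> le1 \<rho> \<xi> (\<gamma> \<oplus> u)"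
    proof (cases "\<xi> \<le> \<gamma>")
      case True
      then show ?thesis using not_le1_across[OF assms(1)] assms(2) by simp
    next
      case False
      then have "\<gamma> < \<xi>" by simp
      then obtain v where v: "\<xi> = \<gamma> \<oplus> v" using le_oadd_cases order_less_imp_le by metis
      then have "\<zero> < v" using \<open>\<gamma> < \<xi>\<close> by simp
      then show ?thesis
        using minimalD[OF u, of v] shift_le1_iff[OF assms(1), of v u] \<xi> v by auto
    qed
  qed
qed

section \<open>The enumeration of the minimal elements\<close>

lemma kappa_strict_mono:
  "Fin \<delta> < theta1 \<rho> \<Longrightarrow> Fin \<delta>' < theta1 \<rho> \<Longrightarrow> kappa \<rho> \<delta> < kappa \<rho> \<delta>' \<longleftrightarrow> \<delta> < \<delta>'"
  using kappa_increasing_enum[of \<rho>] strict_mono_on_less[of "{\<alpha>. Fin \<alpha> < theta1 \<rho>}" "kappa \<rho>"]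
  unfolding increasing_enum_def by simp

lemma kappa_minimal: "Fin \<delta> < theta1 \<rho> \<Longrightarrow> kappa \<rho> \<delta> \<in> le1_minimal \<rho>"
  using kappa_increasing_enum[of \<rho>] unfolding increasing_enum_def by blast

lemma minimal_kappa:
  assumes "\<mu> \<in> le1_minimal \<rho>"
  obtains \<delta> where "Fin \<delta> < theta1 \<rho>" "\<mu> = kappa \<rho> \<delta>"
  using kappa_increasing_enum[of \<rho>] assms unfolding increasing_enum_def by blast

lemma theta1_down: "Fin \<delta> < theta1 \<rho> \<Longrightarrow> \<epsilon> \<le> \<delta> \<Longrightarrow> Fin \<epsilon> < theta1 \<rho>"
  by (cases "theta1 \<rho>") auto

text \<open>By transitivity the least ordinal that is \<open>le1\<close> \<beta> is minimal. Hence
  the sets \<open>I_set\<close> exhaust the ordinals.\<close>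

lemma ex_minimal_le1:
  obtains \<mu> where "\<mu> \<in> le1_minimal \<rho>" "le1 \<rho> \<mu> \<beta>"
proof -
  define \<mu> where "\<mu> = (LEAST \<mu>. le1 \<rho> \<mu> \<beta>)"
  have \<mu>: "le1 \<rho> \<mu> \<beta>" unfolding \<mu>_def using le1_refl by (rule LeastI)
  have "\<mu> \<in> le1_minimal \<rho>"
    by (rule minimalI) (use \<mu> le1_trans not_less_Least \<mu>_def in blast)
  then show ?thesis using that \<mu> by blast
qed

text \<open>If \<open>kappa \<rho> (\<alpha> \<oplus> \<one>)\<close> were a limit, then \<open>kappa \<rho> \<alpha>\<close>, being \<open>\<le>\<^sub>1\<close> everything between the
  two, would be \<open>\<le>\<^sub>1\<close> the limit as well, since only finite sets are reflected.\<close>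

lemma kappa_successor:
  assumes "Fin (\<alpha> \<oplus> \<one>) < theta1 \<rho>"
  obtains \<gamma> where "kappa \<rho> (\<alpha> \<oplus> \<one>) = \<gamma> \<oplus> \<one>"
proof -
  define \<mu> where "\<mu> = kappa \<rho> (\<alpha> \<oplus> \<one>)"
  have \<alpha>: "Fin \<alpha> < theta1 \<rho>" using assms oadd_ge_left by (rule theta1_down)
  have less: "kappa \<rho> \<alpha> < \<mu>" unfolding \<mu>_def using kappa_strict_mono[OF \<alpha> assms] by simp
  have \<mu>: "\<mu> \<in> le1_minimal \<rho>" unfolding \<mu>_def by (rule kappa_minimal[OF assms])
  \<comment> \<open>The minimal \<nu> that is \<open>le1\<close> \<beta> has index at most \<alpha>;
    by \<open>le1_initial\<close> it is \<open>le1\<close> \<open>kappa \<rho> \<alpha>\<close>,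
    hence equal to it.\<close>
  have le1: "le1 \<rho> (kappa \<rho> \<alpha>) \<beta>" if \<beta>: "kappa \<rho> \<alpha> \<le> \<beta>" "\<beta> < \<mu>" for \<beta>
  proof -
    obtain \<nu> where \<nu>: "\<nu> \<in> le1_minimal \<rho>" "le1 \<rho> \<nu> \<beta>" by (rule ex_minimal_le1)
    obtain \<delta> where \<delta>: "Fin \<delta> < theta1 \<rho>" "\<nu> = kappa \<rho> \<delta>" using \<nu>(1) by (rule minimal_kappa)
    have "kappa \<rho> \<delta> < \<mu>" using le1_imp_le[OF \<nu>(2)] \<beta>(2) unfolding \<delta>(2) by (rule order.strict_trans1)
    then have "\<delta> \<le> \<alpha>" unfolding \<mu>_def using kappa_strict_mono[OF \<delta>(1) assms] by simp
    then have "\<nu> \<le> kappa \<rho> \<alpha>"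
      using kappa_strict_mono[OF \<delta>(1) \<alpha>] unfolding \<delta>(2) by (cases "\<delta> = \<alpha>") auto
    then have "le1 \<rho> \<nu> (kappa \<rho> \<alpha>)" using le1_initial[OF \<nu>(2)] \<beta>(1) by blast
    then have "\<nu> = kappa \<rho> \<alpha>" by (rule minimalD[OF kappa_minimal[OF \<alpha>]])
    then show ?thesis using \<nu>(2) by simp
  qed
  have "\<exists>\<gamma>. \<mu> = \<gamma> \<oplus> \<one>"
  proof (rule ccontr)
    assume "\<nexists>\<gamma>. \<mu> = \<gamma> \<oplus> \<one>"
    then have succ: "\<beta> \<oplus> \<one> < \<mu>" if "\<beta> < \<mu>" for \<beta>
      using succ_le_iff[of \<beta> \<mu>] that order_le_less by blast
    have "\<exists>g. reflects (kappa \<rho> \<alpha>) Z g" if Z: "finite Z" "Z \<subseteq> {..<\<mu>}" "rho_closed \<rho> Z" for Z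
    proof -
      \<comment> \<open>A finite Z is bounded strictly inside the limit \<mu>, so reflection from
        the successor of m suffices.\<close>
      define m where "m = Max (insert (kappa \<rho> \<alpha>) Z)"
      have "m \<in> insert (kappa \<rho> \<alpha>) Z" unfolding m_def using Z(1) by (intro Max_in) auto
      then have "m < \<mu>" using Z(2) less by blast
      have m: "kappa \<rho> \<alpha> \<le> m" "\<And>z. z \<in> Z \<Longrightarrow> z \<le> m"
        unfolding m_def using Z(1) by (auto intro: Max_ge)
      have "kappa \<rho> \<alpha> \<le> m \<oplus> \<one>" using m(1) oadd_ge_left by (rule order_trans)
      then have "le1 \<rho> (kappa \<rho> \<alpha>) (m \<oplus> \<one>)" using le1 succ[OF \<open>m < \<mu>\<close>] by blast
      moreover have "Z \<subseteq> {..<m \<oplus> \<one>}" using m(2) by auto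
      ultimately show ?thesis using Z unfolding le1_reflects[of "kappa \<rho> \<alpha>"] by blast
    qed
    then have "le1 \<rho> (kappa \<rho> \<alpha>) \<mu>"
      using less unfolding le1_reflects[of "kappa \<rho> \<alpha>"] by simp
    then show False using minimalD[OF \<mu>] less by blast
  qed
  then show thesis using that unfolding \<mu>_def by blast
qed

text \<open>Zero is minimal and therefore enumerated first. Positivity of \<beta> thus becomes
  positivity of \<open>kappa \<rho> \<beta>\<close>, where translation is available.\<close>

lemma kappa_pos:
  assumes "Fin \<delta> < theta1 \<rho>"
  shows "\<zero> < kappa \<rho> \<delta> \<longleftrightarrow> \<zero> < \<delta>"
proof -
  obtain \<epsilon> where \<epsilon>: "Fin \<epsilon> < theta1 \<rho>" "\<zero> = kappa \<rho> \<epsilon>" using zero_minimal by (rule minimal_kappa)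
  have z: "Fin \<zero> < theta1 \<rho>" using assms ozero_le by (rule theta1_down)
  have "\<not> \<zero> < \<epsilon>" using kappa_strict_mono[OF z \<epsilon>(1)] \<epsilon>(2)[symmetric] by simp
  then have "\<epsilon> = \<zero>" by (simp add: ozero_less_iff)
  then show ?thesis using kappa_strict_mono[OF z assms] \<epsilon>(2) by simp
qed

text \<open>From \<open>\<gamma> \<oplus> \<one>\<close> on, the minimal ordinals are exactly the
  translates of the positive minimal ones, so the two enumerations run in parallel.\<close>

lemma kappa_oadd:
  assumes \<alpha>: "Fin (\<alpha> \<oplus> \<one>) < theta1 \<rho>" and \<gamma>: "kappa \<rho> (\<alpha> \<oplus> \<one>) = \<gamma> \<oplus> \<one>"
  shows "\<zero> < \<beta> \<Longrightarrow> Fin \<beta> < theta1 \<rho> \<Longrightarrow>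
    Fin (\<alpha> \<oplus> \<beta>) < theta1 \<rho> \<and> kappa \<rho> (\<alpha> \<oplus> \<beta>) = \<gamma> \<oplus> kappa \<rho> \<beta>"
proof (induction \<beta> rule: less_induct)
  case (less \<beta>)
  have minimal: "\<gamma> \<oplus> \<one> \<in> le1_minimal \<rho>" using kappa_minimal[OF \<alpha>] \<gamma> by simp
  have pos: "\<zero> < kappa \<rho> \<beta>" using less.prems by (simp add: kappa_pos)
  then have "\<gamma> \<oplus> kappa \<rho> \<beta> \<in> le1_minimal \<rho>"
    using shift_minimal_iff[OF minimal pos] kappa_minimal[OF less.prems(2)] by simp
  then obtain \<delta> where \<delta>: "Fin \<delta> < theta1 \<rho>" "\<gamma> \<oplus> kappa \<rho> \<beta> = kappa \<rho> \<delta>" by (rule minimal_kappa)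
  have IH: "Fin (\<alpha> \<oplus> \<beta>') < theta1 \<rho>" "kappa \<rho> (\<alpha> \<oplus> \<beta>') = \<gamma> \<oplus> kappa \<rho> \<beta>'"
    "kappa \<rho> \<beta>' < kappa \<rho> \<beta>" if "\<zero> < \<beta>'" "\<beta>' < \<beta>" for \<beta>'
  proof -
    have D: "Fin \<beta>' < theta1 \<rho>"
      using less.prems(2) order_less_imp_le[OF that(2)] by (rule theta1_down)
    show "Fin (\<alpha> \<oplus> \<beta>') < theta1 \<rho>" "kappa \<rho> (\<alpha> \<oplus> \<beta>') = \<gamma> \<oplus> kappa \<rho> \<beta>'"
      using less.IH[OF that(2,1) D] by simp_all
    show "kappa \<rho> \<beta>' < kappa \<rho> \<beta>" using kappa_strict_mono[OF D less.prems(2)] that(2) by simp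
  qed
  \<comment> \<open>A smaller index would be \<open>\<alpha> \<oplus> \<beta>'\<close> with \<beta>'
    positive and below \<beta>, whose value is already known to be smaller. This also shows that
    \<open>\<alpha> \<oplus> \<beta>\<close> is an index at all.\<close>
  have "\<alpha> \<oplus> \<beta> \<le> \<delta>"
  proof (rule ccontr)
    assume "\<not> \<alpha> \<oplus> \<beta> \<le> \<delta>"
    then have lt: "\<delta> < \<alpha> \<oplus> \<beta>" by simp
    have "\<not> \<gamma> \<oplus> kappa \<rho> \<beta> < \<gamma> \<oplus> \<one>" using pos by (simp add: not_le)
    then have "\<not> \<delta> < \<alpha> \<oplus> \<one>"
      using kappa_strict_mono[OF \<delta>(1) \<alpha>] unfolding \<gamma> \<delta>(2)[symmetric] by simp
    then have "\<alpha> < \<delta>" by simp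
    then obtain \<beta>' where \<beta>': "\<delta> = \<alpha> \<oplus> \<beta>'" using le_oadd_cases order_less_imp_le by metis
    then have "\<zero> < \<beta>'" "\<beta>' < \<beta>" using \<open>\<alpha> < \<delta>\<close> lt by simp_all
    then show False using IH(2,3)[of \<beta>'] \<delta>(2) \<beta>' by simp
  qed
  then have D: "Fin (\<alpha> \<oplus> \<beta>) < theta1 \<rho>" using \<delta>(1) theta1_down by blast
  have "\<alpha> < \<alpha> \<oplus> \<beta>" using less.prems(1) by simp
  then have "\<not> \<alpha> \<oplus> \<beta> < \<alpha> \<oplus> \<one>" by (simp add: not_le)
  then have "\<not> kappa \<rho> (\<alpha> \<oplus> \<beta>) < \<gamma> \<oplus> \<one>" using kappa_strict_mono[OF D \<alpha>] unfolding \<gamma> by simp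
  then have "\<gamma> < kappa \<rho> (\<alpha> \<oplus> \<beta>)" by simp
  then obtain u where u: "kappa \<rho> (\<alpha> \<oplus> \<beta>) = \<gamma> \<oplus> u" using le_oadd_cases order_less_imp_le by metis
  then have "\<zero> < u" using \<open>\<gamma> < kappa \<rho> (\<alpha> \<oplus> \<beta>)\<close> by simp
  then have "u \<in> le1_minimal \<rho>" using shift_minimal_iff[OF minimal] kappa_minimal[OF D] u by simp
  then obtain \<epsilon> where \<epsilon>: "Fin \<epsilon> < theta1 \<rho>" "u = kappa \<rho> \<epsilon>" by (rule minimal_kappa)
  \<comment> \<open>The reverse inequality: the minimal ordinal of index
    \<open>\<alpha> \<oplus> \<beta>\<close> is a translate not yet used at smaller indices.\<close>
  have "\<not> \<epsilon> < \<beta>"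
  proof
    assume "\<epsilon> < \<beta>"
    have "\<zero> < \<epsilon>" using \<open>\<zero> < u\<close> \<epsilon> kappa_pos by simp
    then have "kappa \<rho> (\<alpha> \<oplus> \<epsilon>) < kappa \<rho> (\<alpha> \<oplus> \<beta>)"
      using kappa_strict_mono[OF IH(1) D] \<open>\<epsilon> < \<beta>\<close> by simp
    then show False using IH(2)[OF \<open>\<zero> < \<epsilon>\<close> \<open>\<epsilon> < \<beta>\<close>] u \<epsilon>(2) by simp
  qed
  then have "\<not> kappa \<rho> \<epsilon> < kappa \<rho> \<beta>" using kappa_strict_mono[OF \<epsilon>(1) less.prems(2)] by simp
  moreover have "\<not> kappa \<rho> \<delta> < kappa \<rho> (\<alpha> \<oplus> \<beta>)"
    using kappa_strict_mono[OF \<delta>(1) D] \<open>\<alpha> \<oplus> \<beta> \<le> \<delta>\<close> by simp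
  ultimately have "kappa \<rho> (\<alpha> \<oplus> \<beta>) = \<gamma> \<oplus> kappa \<rho> \<beta>"
    using u \<epsilon>(2) \<delta>(2)[symmetric] by (simp add: not_less order_antisym)
  then show ?case using D by simp
qed

lemma pattern_iso_sym:
  assumes "pattern_iso \<rho> A B"
  shows "pattern_iso \<rho> B A"
proof -
  obtain h where h: "bij_betw h A B" "strict_mono_on A h"
    "\<And>\<xi> x y. \<xi> < \<rho> \<Longrightarrow> x \<in> A \<Longrightarrow> y \<in> A \<Longrightarrow> f_xi \<rho> \<xi> x = y \<longleftrightarrow> f_xi \<rho> \<xi> (h x) = h y"
    "\<And>x y. x \<in> A \<Longrightarrow> y \<in> A \<Longrightarrow> le1 \<rho> x y \<longleftrightarrow> le1 \<rho> (h x) (h y)"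
    "\<And>x y. x \<in> A \<Longrightarrow> y \<in> A \<Longrightarrow> le2 \<rho> x y \<longleftrightarrow> le2 \<rho> (h x) (h y)"
    using assms unfolding pattern_iso_def by blast
  let ?k = "inv_into A h"
  have k: "?k z \<in> A" "h (?k z) = z" if "z \<in> B" for z
    using h(1) that unfolding bij_betw_def by (auto intro: inv_into_into f_inv_into_f)
  have "strict_mono_on B ?k"
    using strict_mono_on_less[OF h(2)] k by (intro strict_mono_onI) metis
  then show ?thesis
    unfolding pattern_iso_def using bij_betw_inv_into[OF h(1)] h(3-5) k
    by (intro exI[of _ ?k]) simp
qed

theorem I_set_shift:
  assumes \<alpha>: "Fin (\<alpha> \<oplus> \<one>) < theta1 \<rho>" and \<beta>: "\<zero> < \<beta>" "Fin \<beta> < theta1 \<rho>"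
  shows "Fin (\<alpha> \<oplus> \<beta>) < theta1 \<rho> \<and> pattern_iso \<rho> (I_set \<rho> (\<alpha> \<oplus> \<beta>)) (I_set \<rho> \<beta>)"
proof -
  obtain \<gamma> where \<gamma>: "kappa \<rho> (\<alpha> \<oplus> \<one>) = \<gamma> \<oplus> \<one>" using \<alpha> by (rule kappa_successor)
  have minimal: "\<gamma> \<oplus> \<one> \<in> le1_minimal \<rho>" using kappa_minimal[OF \<alpha>] \<gamma> by simp
  have kappa: "Fin (\<alpha> \<oplus> \<beta>) < theta1 \<rho>" "kappa \<rho> (\<alpha> \<oplus> \<beta>) = \<gamma> \<oplus> kappa \<rho> \<beta>"
    using kappa_oadd[OF \<alpha> \<gamma> \<beta>] by simp_all
  have pos: "\<zero> < kappa \<rho> \<beta>" using \<beta> by (simp add: kappa_pos)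
  have I_pos: "\<zero> < u" if "u \<in> I_set \<rho> \<beta>" for u
    using le1_imp_le pos that unfolding I_set_def by (blast intro: order.strict_trans2)
  have image: "(\<oplus>) \<gamma> ` I_set \<rho> \<beta> = I_set \<rho> (\<alpha> \<oplus> \<beta>)"
  proof (intro equalityI subsetI)
    fix w assume "w \<in> I_set \<rho> (\<alpha> \<oplus> \<beta>)"
    then have w: "le1 \<rho> (\<gamma> \<oplus> kappa \<rho> \<beta>) w" by (simp add: I_set_def kappa)
    have "\<gamma> \<le> w" using oadd_ge_left le1_imp_le[OF w] by (rule order_trans)
    then obtain u where "w = \<gamma> \<oplus> u" by (rule le_oadd_cases)
    then show "w \<in> (\<oplus>) \<gamma> ` I_set \<rho> \<beta>"
      using w shift_le1_iff[OF minimal pos] by (simp add: I_set_def)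
  qed (auto simp: I_set_def kappa shift_le1_iff[OF minimal pos])
  have f: "f_xi \<rho> \<xi> x = y \<longleftrightarrow> f_xi \<rho> \<xi> (\<gamma> \<oplus> x) = \<gamma> \<oplus> y"
    if xy: "x \<in> I_set \<rho> \<beta>" "y \<in> I_set \<rho> \<beta>" for \<xi> x y
  proof (cases "\<rho> \<le> x")
    case True
    then show ?thesis by (simp add: f_xi_shift)
  next
    case False
    have le: "le1 \<rho> (kappa \<rho> \<beta>) x" "le1 \<rho> (kappa \<rho> \<beta>) y" using xy by (simp_all add: I_set_def)
    have "kappa \<rho> \<beta> < \<rho>" using le1_imp_le[OF le(1)] False by simp
    \<comment> \<open>Below \<rho> translation may fail to commute with \<open>f_xi\<close>. But a
      positive ordinal below \<rho> is no multiple of \<rho>, so x and y are both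
      \<open>kappa \<rho> \<beta>\<close>, and neither it nor its translate is fixed by any
      \<open>f_xi\<close>.\<close>
    then have "\<not> dv (kappa \<rho> \<beta>)" using rho_le_dv pos linorder_not_le by blast
    then have "x = kappa \<rho> \<beta>" "y = x"
      using le le1_less_dv le1_imp_le order_le_less by metis+
    \<comment> \<open>The translate lies less than \<rho> above \<gamma>, which contradicts the
      criterion \<open>dv_iff\<close> at \<gamma>.\<close>
    moreover have "\<not> dv (\<gamma> \<oplus> x)"
      unfolding dv_iff using False \<open>x = kappa \<rho> \<beta>\<close> pos by (auto intro!: exI[of _ \<gamma>])
    ultimately show ?thesis using f_xi_fixed \<open>\<not> dv (kappa \<rho> \<beta>)\<close> by blast
  qed
  have "pattern_iso \<rho> (I_set \<rho> \<beta>) (I_set \<rho> (\<alpha> \<oplus> \<beta>))"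
    unfolding pattern_iso_def
  proof (intro exI[of _ "(\<oplus>) \<gamma>"] conjI allI impI ballI)
    show "bij_betw ((\<oplus>) \<gamma>) (I_set \<rho> \<beta>) (I_set \<rho> (\<alpha> \<oplus> \<beta>))"
      using image by (simp add: bij_betw_def inj_on_def)
    show "strict_mono_on (I_set \<rho> \<beta>) ((\<oplus>) \<gamma>)" by (simp add: strict_mono_on_def)
  qed (simp_all add: f shift_le1_iff[OF minimal I_pos] shift_le2_iff[OF minimal I_pos])
  then show ?thesis using kappa(1) pattern_iso_sym by blast
qed

end

text \<open>The first conjunct ensures that \<open>kappa\<close> is meaningful at
  \<open>\<alpha> \<oplus> \<beta>\<close>.\<close>

theorem theorem5p9:
  fixes \<rho> \<alpha> \<beta> :: "'a::ordinals"
  assumes "additively_indecomposable \<rho>"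
    and "Fin (\<alpha> \<oplus> \<one>) < theta1 \<rho>"
    and "\<zero> < \<beta>" and "Fin \<beta> < theta1 \<rho>"
  shows "Fin (\<alpha> \<oplus> \<beta>) < theta1 \<rho> \<and> pattern_iso \<rho> (I_set \<rho> (\<alpha> \<oplus> \<beta>)) (I_set \<rho> \<beta>)"
proof -
  interpret indecomposable \<rho> using assms(1) by unfold_locales
  show ?thesis using assms(2-4) by (rule I_set_shift)
qed

end
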